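(* There exist universal constants $c,c'>0$ and, for every $\alpha>2$, a number $C(\alpha)$ with $0<C(\alpha)<1$ and $C(\alpha)\ge 1-\frac{c\log\alpha}{\alpha}$, such that for every $p\ge 1$, every $\alpha>2$ and every integer $n\ge 1$, $$R_{\ell_p^d}(\alpha,n)\ \ge\ n^{C(\alpha)},\qquad\text{where } d=\left\lceil \left\lceil \frac{c'}{(\alpha-2)^2}\right\rceil C(\alpha)\log n\right\rceil .$$
   Context: For an injective map $f:X\to Y$ between metric spaces, its distortion is $\mathrm{dist}(f)=\sup_{x\ne y}\frac{d_Y(f(x),f(y))}{d_X(x,y)}\cdot\sup_{x\neq y}\frac{d_X(x,y)}{d_Y(f(x),f(y))}$ (equal to $1$ if $|X|=1$). $c_Y(X)$ is the least distortion (infimum) of an embedding of $X$ into $Y$, and $X$ $\alpha$-embeds into $Y$ if $c_Y(X)\le\alpha$. $R_Y(\alpha,n)$ is the largest integer $m$ such that every $n$-point metric space has a subspace of size $m$ that $\alpha$-embeds into $Y$. $\ell_p^d$ is $\mathbb R^d$ with the $\ell_p$ norm. *)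

theory Defs
  imports "HOL-Analysis.Analysis"
begin

(* Distortion takes values in [0, infinity], since either supremum may be infinite.  Without
   distinct points both suprema would be 0, so the value 1 is set by convention. *)
definition distortion :: "'a metric \<Rightarrow> 'b metric \<Rightarrow> ('a \<Rightarrow> 'b) \<Rightarrow> ennreal" where
  "distortion X Y f =
    (if \<exists>a. mspace X \<subseteq> {a} then 1
     else (SUP (x, y) \<in> {(x, y). x \<in> mspace X \<and> y \<in> mspace X \<and> x \<noteq> y}.
             ennreal (mdist Y (f x) (f y) / mdist X x y)) *
          (SUP (x, y) \<in> {(x, y). x \<in> mspace X \<and> y \<in> mspace X \<and> x \<noteq> y}.
             ennreal (mdist X x y / mdist Y (f x) (f y))))"

(* The infimum is infinite if there is no injection of X into Y. *)
definition least_distortion :: "'a metric \<Rightarrow> 'b metric \<Rightarrow> ennreal" where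
  "least_distortion X Y =
    (INF f \<in> {f. f \<in> mspace X \<rightarrow> mspace Y \<and> inj_on f (mspace X)}. distortion X Y f)"

definition embeds_with :: "real \<Rightarrow> 'a metric \<Rightarrow> 'b metric \<Rightarrow> bool" where
  "embeds_with \<alpha> X Y \<longleftrightarrow> least_distortion X Y \<le> ennreal \<alpha>"

(* A quantifier inside a definition cannot range over all types, so the n-point spaces here have
   their points in nat.  By ramsey_property_any_type below this loses nothing. *)
definition ramsey_property :: "'b metric \<Rightarrow> real \<Rightarrow> nat \<Rightarrow> nat \<Rightarrow> bool" where
  "ramsey_property Y \<alpha> n m \<longleftrightarrow>
    (\<forall>X :: nat metric. finite (mspace X) \<and> card (mspace X) = n \<longrightarrow>
       (\<exists>S \<subseteq> mspace X. card S = m \<and> embeds_with \<alpha> (submetric X S) Y))"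

definition ramsey_number :: "'b metric \<Rightarrow> real \<Rightarrow> nat \<Rightarrow> nat" where
  "ramsey_number Y \<alpha> n = (GREATEST m. ramsey_property Y \<alpha> n m)"

definition lp_carrier :: "nat \<Rightarrow> (nat \<Rightarrow> real) set" where
  "lp_carrier d = {..<d} \<rightarrow>\<^sub>E UNIV"

definition lp_dist :: "real \<Rightarrow> nat \<Rightarrow> (nat \<Rightarrow> real) \<Rightarrow> (nat \<Rightarrow> real) \<Rightarrow> real" where
  "lp_dist p d x y = (\<Sum>i<d. \<bar>x i - y i\<bar> powr p) powr (1 / p)"

(* Meaningful for p \<ge> 1 only, see Metric_space_lp.  For d = 0 it is the one-point space. *)
definition lp_space :: "real \<Rightarrow> nat \<Rightarrow> (nat \<Rightarrow> real) metric" where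
  "lp_space p d = metric (lp_carrier d, lp_dist p d)"

lemma powr_convex_nonneg:
  fixes x y t p :: real
  assumes "p \<ge> 1" "x \<ge> 0" "y \<ge> 0" "0 \<le> t" "t \<le> 1"
  shows "((1 - t) * x + t * y) powr p \<le> (1 - t) * x powr p + t * y powr p"
proof -
  have pw: "s powr p \<le> s" if "0 \<le> s" "s \<le> 1" for s :: real
    using that assms(1) powr_mono'[of 1 p s] by (cases "s = 0") auto
  consider "x = 0" | "y = 0" | "x > 0" "y > 0" using assms by linarith
  then show ?thesis
  proof cases
    case 1
    then show ?thesis using assms pw[of t]
      by (simp add: powr_mult mult_right_mono)
  next
    case 2
    then show ?thesis using assms pw[of "1 - t"]
      by (simp add: powr_mult mult_right_mono)
  next
    case 3
    then show ?thesis
      using convex_onD[OF powr_convex[OF assms(1)], of t x y] assms by simp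
  qed
qed

lemma lp_minkowski:
  fixes a b :: "'i \<Rightarrow> real" and p :: real
  assumes p: "p \<ge> 1" and fin: "finite I"
    and nn: "\<And>i. i \<in> I \<Longrightarrow> a i \<ge> 0" "\<And>i. i \<in> I \<Longrightarrow> b i \<ge> 0"
  shows "(\<Sum>i\<in>I. (a i + b i) powr p) powr (1 / p)
    \<le> (\<Sum>i\<in>I. a i powr p) powr (1 / p) + (\<Sum>i\<in>I. b i powr p) powr (1 / p)"
proof -
  define A where "A = (\<Sum>i\<in>I. a i powr p) powr (1 / p)"
  define B where "B = (\<Sum>i\<in>I. b i powr p) powr (1 / p)"
  have Ap: "(\<Sum>i\<in>I. a i powr p) = A powr p" and Bp: "(\<Sum>i\<in>I. b i powr p) = B powr p"
    using p by (simp_all add: A_def B_def powr_powr sum_nonneg)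
  have "A \<ge> 0" "B \<ge> 0" by (simp_all add: A_def B_def)
  have zero: "c i = 0" if "(\<Sum>i\<in>I. c i powr p) = 0" "i \<in> I" for c :: "'i \<Rightarrow> real" and i
    using that fin by (simp add: sum_nonneg_eq_0_iff)
  consider "A = 0" | "B = 0" | "A > 0" "B > 0" using \<open>A \<ge> 0\<close> \<open>B \<ge> 0\<close> by linarith
  then have "(\<Sum>i\<in>I. (a i + b i) powr p) powr (1 / p) \<le> A + B"
  proof cases
    case 1
    then have "a i = 0" if "i \<in> I" for i using zero[of a] Ap that by simp
    then have "(\<Sum>i\<in>I. (a i + b i) powr p) = (\<Sum>i\<in>I. b i powr p)"
      by (intro sum.cong) auto
    then show ?thesis using 1 by (simp add: B_def)
  next
    case 2
    then have "b i = 0" if "i \<in> I" for i using zero[of b] Bp that by simp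
    then have "(\<Sum>i\<in>I. (a i + b i) powr p) = (\<Sum>i\<in>I. a i powr p)"
      by (intro sum.cong) auto
    then show ?thesis using 2 by (simp add: A_def)
  next
    case 3
    define t where "t = B / (A + B)"
    have t: "0 \<le> t" "t \<le> 1" "1 - t = A / (A + B)" using 3 by (auto simp: t_def field_simps)
    have "(a i + b i) powr p
        \<le> (A + B) powr p * ((1 - t) * (a i powr p / A powr p) + t * (b i powr p / B powr p))"
      if i: "i \<in> I" for i
    proof -
      have "a i + b i = (A + B) * ((1 - t) * (a i / A) + t * (b i / B))"
      proof -
        have "(A + B) * (1 - t) = A" "(A + B) * t = B" using 3 by (simp only: t(3), simp, simp add: t_def)
        then have "(A + B) * ((1 - t) * (a i / A) + t * (b i / B)) = A * (a i / A) + B * (b i / B)"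
          by (simp only: distrib_left mult.assoc[symmetric])
        then show ?thesis using 3 by simp
      qed
      then have "(a i + b i) powr p = (A + B) powr p * ((1 - t) * (a i / A) + t * (b i / B)) powr p"
        using 3 nn[OF i] t by (simp add: powr_mult)
      also have "\<dots> \<le> (A + B) powr p * ((1 - t) * (a i / A) powr p + t * (b i / B) powr p)"
        using 3 nn[OF i] t p by (intro mult_left_mono powr_convex_nonneg) auto
      also have "\<dots> = (A + B) powr p * ((1 - t) * (a i powr p / A powr p) + t * (b i powr p / B powr p))"
        using 3 nn[OF i] by (simp add: powr_divide)
      finally show ?thesis .
    qed
    then have "(\<Sum>i\<in>I. (a i + b i) powr p)
        \<le> (\<Sum>i\<in>I. (A + B) powr p * ((1 - t) * (a i powr p / A powr p) + t * (b i powr p / B powr p)))"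
      by (rule sum_mono)
    also have "\<dots> = (A + B) powr p * ((1 - t) * ((\<Sum>i\<in>I. a i powr p) / A powr p)
                    + t * ((\<Sum>i\<in>I. b i powr p) / B powr p))"
      by (simp add: sum_distrib_left sum_divide_distrib sum.distrib distrib_left)
    also have "\<dots> = (A + B) powr p" using 3 by (simp add: Ap Bp)
    finally have "(\<Sum>i\<in>I. (a i + b i) powr p) powr (1 / p) \<le> ((A + B) powr p) powr (1 / p)"
      using p by (intro powr_mono2) (auto intro: sum_nonneg)
    then show ?thesis using p 3 by (simp add: powr_powr)
  qed
  then show ?thesis by (simp add: A_def B_def)
qed

lemma Metric_space_lp:
  assumes p: "p \<ge> 1"
  shows "Metric_space (lp_carrier d) (lp_dist p d)"
proof
  show "0 \<le> lp_dist p d x y" for x y by (simp add: lp_dist_def)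
  show "lp_dist p d x y = lp_dist p d y x" for x y by (simp add: lp_dist_def abs_minus_commute)
  show "lp_dist p d x y = 0 \<longleftrightarrow> x = y" if "x \<in> lp_carrier d" "y \<in> lp_carrier d" for x y
  proof
    assume "lp_dist p d x y = 0"
    then have "x i = y i" if "i < d" for i
      using that by (simp add: lp_dist_def sum_nonneg_eq_0_iff)
    then show "x = y" using that unfolding lp_carrier_def by (intro PiE_ext) auto
  qed (simp add: lp_dist_def)
  show "lp_dist p d x z \<le> lp_dist p d x y + lp_dist p d y z" for x y z
  proof -
    have "lp_dist p d x z \<le> (\<Sum>i<d. (\<bar>x i - y i\<bar> + \<bar>y i - z i\<bar>) powr p) powr (1 / p)"
      unfolding lp_dist_def using p by (intro powr_mono2 sum_mono) (auto intro: sum_nonneg)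
    also have "\<dots> \<le> lp_dist p d x y + lp_dist p d y z"
      unfolding lp_dist_def by (rule lp_minkowski[OF p]) auto
    finally show ?thesis .
  qed
qed

lemma mspace_lp_space [simp]: "p \<ge> 1 \<Longrightarrow> mspace (lp_space p d) = lp_carrier d"
  unfolding lp_space_def by (rule Metric_space.mspace_metric[OF Metric_space_lp])

lemma mdist_lp_space [simp]: "p \<ge> 1 \<Longrightarrow> mdist (lp_space p d) = lp_dist p d"
  unfolding lp_space_def by (rule Metric_space.mdist_metric[OF Metric_space_lp])

lemma least_distortion_isometry:
  assumes g: "bij_betw g (mspace Z) (mspace X)"
    and iso: "\<And>x y. x \<in> mspace Z \<Longrightarrow> y \<in> mspace Z \<Longrightarrow> mdist X (g x) (g y) = mdist Z x y"
  shows "least_distortion X Y \<le> least_distortion Z Y"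
  unfolding least_distortion_def
proof (rule INF_greatest, clarify)
  fix f assume f: "f \<in> mspace Z \<rightarrow> mspace Y" "inj_on f (mspace Z)"
  define h where "h = the_inv_into (mspace Z) g"
  have inj: "inj_on g (mspace Z)" and im: "g ` mspace Z = mspace X"
    using g by (auto simp: bij_betw_def)
  have hb: "bij_betw h (mspace X) (mspace Z)"
    unfolding h_def using g by (rule bij_betw_the_inv_into)
  have hg: "h (g z) = z" if "z \<in> mspace Z" for z
    using that inj by (simp add: h_def the_inv_into_f_f)
  have pairs: "{(x, y). x \<in> mspace X \<and> y \<in> mspace X \<and> x \<noteq> y}
      = (\<lambda>(x, y). (g x, g y)) ` {(x, y). x \<in> mspace Z \<and> y \<in> mspace Z \<and> x \<noteq> y}"
    using inj by (auto simp: im[symmetric] inj_on_def image_iff)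
  have single: "(\<exists>a. mspace X \<subseteq> {a}) \<longleftrightarrow> (\<exists>a. mspace Z \<subseteq> {a})"
  proof -
    have sub1: "(\<exists>a. S \<subseteq> {a}) \<longleftrightarrow> (\<forall>x\<in>S. \<forall>y\<in>S. x = y)" for S :: "'t set"
      by blast
    show ?thesis using inj by (simp add: sub1 im[symmetric] inj_on_eq_iff)
  qed
  have "distortion X Y (f \<circ> h) = distortion Z Y f"
  proof -
    have "(\<lambda>(x, y). ennreal (mdist Y ((f \<circ> h) x) ((f \<circ> h) y) / mdist X x y)) ((\<lambda>(x, y). (g x, g y)) q)
        = (\<lambda>(x, y). ennreal (mdist Y (f x) (f y) / mdist Z x y)) q"
      "(\<lambda>(x, y). ennreal (mdist X x y / mdist Y ((f \<circ> h) x) ((f \<circ> h) y))) ((\<lambda>(x, y). (g x, g y)) q)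
        = (\<lambda>(x, y). ennreal (mdist Z x y / mdist Y (f x) (f y))) q"
      if "q \<in> {(x, y). x \<in> mspace Z \<and> y \<in> mspace Z \<and> x \<noteq> y}" for q
      using that by (auto simp: hg iso)
    then show ?thesis
      unfolding distortion_def single pairs image_image by (simp only: cong: image_cong)
  qed
  moreover have "f \<circ> h \<in> mspace X \<rightarrow> mspace Y" "inj_on (f \<circ> h) (mspace X)"
    using f hb by (auto simp: bij_betw_def Pi_iff intro: comp_inj_on)
  ultimately show "(INF f \<in> {f. f \<in> mspace X \<rightarrow> mspace Y \<and> inj_on f (mspace X)}. distortion X Y f)
      \<le> distortion Z Y f"
    by (intro INF_lower2[of "f \<circ> h"]) auto
qed

lemma ramsey_property_any_type:
  fixes X :: "'a metric"
  assumes R: "ramsey_property Y \<alpha> n m"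
    and fin: "finite (mspace X)" and card: "card (mspace X) = n"
  shows "\<exists>S \<subseteq> mspace X. card S = m \<and> embeds_with \<alpha> (submetric X S) Y"
proof -
  obtain g :: "nat \<Rightarrow> 'a" where g: "bij_betw g {..<n} (mspace X)"
    using ex_bij_betw_nat_finite[OF fin] card by (auto simp: atLeast0LessThan)
  define e where "e = (\<lambda>x y. mdist X (g x) (g y))"
  have inj: "inj_on g {..<n}" and im: "g ` {..<n} = mspace X" using g by (auto simp: bij_betw_def)
  have gm: "g x \<in> mspace X" if "x < n" for x using im that by auto
  have M: "Metric_space {..<n} e"
  proof
    show "0 \<le> e x y" for x y by (simp add: e_def)
    show "e x y = e y x" for x y by (simp add: e_def mdist_commute)
    show "e x y = 0 \<longleftrightarrow> x = y" if "x \<in> {..<n}" "y \<in> {..<n}" for x y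
      using that inj gm by (auto simp: e_def inj_on_def)
    show "e x z \<le> e x y + e y z" if "x \<in> {..<n}" "y \<in> {..<n}" "z \<in> {..<n}" for x y z
      using that gm by (auto simp: e_def intro: mdist_triangle)
  qed
  define Z where "Z = metric ({..<n}, e)"
  have Z: "mspace Z = {..<n}" "mdist Z = e"
    unfolding Z_def using Metric_space.mspace_metric[OF M] Metric_space.mdist_metric[OF M] by auto
  obtain S where S: "S \<subseteq> {..<n}" "card S = m" "embeds_with \<alpha> (submetric Z S) Y"
    using R Z unfolding ramsey_property_def by (metis card_lessThan finite_lessThan)
  have injS: "inj_on g S" using inj S(1) by (rule inj_on_subset)
  have sub: "g ` S \<subseteq> mspace X" using S(1) im by auto
  have "least_distortion (submetric X (g ` S)) Y \<le> least_distortion (submetric Z S) Y"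
  proof (rule least_distortion_isometry[of g])
    show "bij_betw g (mspace (submetric Z S)) (mspace (submetric X (g ` S)))"
      using S(1) sub injS by (simp add: Z bij_betw_def Int_absorb2)
  qed (simp add: Z e_def)
  then have "embeds_with \<alpha> (submetric X (g ` S)) Y"
    using S(3) unfolding embeds_with_def by (rule order_trans)
  then show ?thesis using sub S(2) card_image[OF injS] by blast
qed

end

theory Submission
  imports Defs
begin

text \<open>
  The proof splits an $n$-point space at geometrically spaced scales and then realises the resulting
  hierarchy by error-correcting codes.

  \<^emph>\<open>Splitting.\<close>  Fix radii $a \le b$.  Repeatedly pick a centre $x$, make the points within
  distance $a$ of $x$ a cluster, and discard the points at distance in $(a, b]$ from $x$.  Distinct
  clusters are then more than $b - a$ apart, and each cluster has diameter at most $2a$.  With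
  uniformly random centres a point $y$ survives with probability $|B(y,a)| / |B(y,b)|$;
  \<open>fragment_one_scale\<close> gets this bound without randomness by choosing each centre at least as good
  as the average one, for arbitrary point weights.  As weights are allowed, the step can be iterated
  over all scales (\<open>fragment_scales\<close>), and the number of survivors is at least the sum over $y$ of
  the product of these ratios.

  \<^emph>\<open>Choosing the scales.\<close>  Let $a_k = u \mu^{Tk+\tau}$ and $b_k = \mu^q a_k$ with $q < T$.  On a
  logarithmic scale the intervals $[a_k, b_k]$ fill the fraction $q/T$, while the ratios
  $|B(y,r)| / |B(y,\mu r)|$ telescope along the whole scale to a product of at least $1/n$.  Hence
  for some shift $\tau$ at least $n^{1-q/T}$ points survive (\<open>exists_good_shift\<close>).  Two
  survivors that are separated for the last time at level $k$ have distance between $b_k - a_k$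
  and $2 a_{k+1}$; these bounds differ by the factor $2 \mu^T / (\mu^q - 1)$.

  \<^emph>\<open>Embedding.\<close>  Assign to the clusters of each level words of a code whose words have
  almost equal $\ell_p$ distances, and add up these words with weights $K^k$, where $K = \mu^T$.  If
  $K$ is large then the level at which two points are separated for the last time dominates
  the sum, so the map is nearly an embedding of the hierarchy (\<open>embeds_hierarchy_into_lp\<close>).  Binary
  words of length $d$ with all Hamming distances in $[(1-\eta) d/2, (1+\eta) d/2]$ exist in
  number exponential in $\eta^2 d$, and for them the $p$-th power of an $\ell_p$ distance is a Hamming
  distance, so one code serves for every $p$.

  \<^emph>\<open>Parameters.\<close>  For $\alpha$ close to $2$ take $\mu$ close to $1$, then $q$ so large that $\mu^q$ is
  large, and $T = q + 1$: then $2 \mu^T / (\mu^q - 1)$ is close to $2$, and the exponent $1/(q+1)$ is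
  positive.  For large $\alpha$ take $q = 1$ and $T$ proportional to $\alpha$, with $\mu^T$ a fixed large
  number: then $\mu - 1$ has order at least $1/T$, so the distortion is $O(T)$ and the exponent is
  $1 - 1/T = 1 - O(1/\alpha)$.  In this range the dimension may be as small as the
  logarithm of the number of points, so blocks of 49 bits are packed into one coordinate of the code.
\<close>

section \<open>Fragmentation at one scale\<close>

text \<open>The library rule \<open>mdist_zero\<close> rewrites only equations with \<open>0\<close>, so it does not simplify
  \<open>mdist X x x\<close> inside an inequality.\<close>

lemma mdist_self: "x \<in> mspace X \<Longrightarrow> mdist X x x = 0"
  by simp

definition ball_card :: "'a metric \<Rightarrow> 'a \<Rightarrow> real \<Rightarrow> nat" where
  "ball_card X y r = card {z \<in> mspace X. mdist X y z \<le> r}"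

text \<open>
  A greedy derandomisation.  Averaged over all centres $x$, the weight of $B(x,a) \cap U$ equals the
  weight of $B(x,b) \cap U$ discounted by the survival ratio: both double sums count a point $y$ with the
  number of centres near it.  So some centre keeps at least as much weight as the points removed
  with it contribute to the bound, and the rest follows by induction on $U$.  The ratio is that of
  balls in the whole space, so it does not change as $U$ shrinks.
\<close>

lemma fragment_one_scale:
  fixes X :: "'a metric" and w :: "'a \<Rightarrow> real"
  defines "N \<equiv> \<lambda>y r. real (ball_card X y r)"
  assumes fin: "finite (mspace X)" and ab: "0 \<le> a" "a \<le> b"
    and U: "U \<subseteq> mspace X" and w: "\<And>y. y \<in> U \<Longrightarrow> 0 \<le> w y"
  shows "\<exists>S g. S \<subseteq> U \<and> (\<forall>y\<in>S. g y \<in> mspace X \<and> mdist X y (g y) \<le> a) \<and>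
    (\<forall>y\<in>S. \<forall>z\<in>S. g y \<noteq> g z \<longrightarrow> b - a < mdist X y z) \<and>
    (\<Sum>y\<in>U. w y * (N y a / N y b)) \<le> (\<Sum>y\<in>S. w y)"
  using finite_subset[OF U fin] U w
proof (induction U rule: finite_psubset_induct)
  case (psubset U)
  define B where "B = (\<lambda>x r. {y \<in> U. mdist X x y \<le> r})"
  \<comment> \<open>Only centres whose outer ball meets \<open>U\<close> are averaged over: the others contribute nothing to
    either sum, and choosing one of these makes \<open>U\<close> strictly smaller.\<close>
  define Z where "Z = {x \<in> mspace X. B x b \<noteq> {}}"
  define p where "p = (\<lambda>y. N y a / N y b)"
  have finZ: "finite Z" using fin by (simp add: Z_def)
  have finU: "finite U" by (rule psubset.hyps)
  show ?case
  proof (cases "U = {}")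
    case True
    then show ?thesis by auto
  next
    case False
    then obtain x0 where x0: "x0 \<in> U" by blast
    then have "x0 \<in> Z" using psubset.prems(1) ab unfolding Z_def B_def by (auto intro!: exI[of _ x0] simp: subset_iff mdist_self)
    have NZ: "N y r = (\<Sum>x\<in>Z. if mdist X x y \<le> r then 1 else 0)" if "y \<in> U" "r \<le> b" for y r
    proof -
      have "{z \<in> mspace X. mdist X y z \<le> r} = {x \<in> Z. mdist X x y \<le> r}"
        using that by (auto simp: Z_def B_def mdist_commute)
      then show ?thesis unfolding N_def ball_card_def using finZ
        by (simp add: sum.If_cases Int_def)
    qed
    have swap: "(\<Sum>x\<in>Z. \<Sum>y\<in>B x r. v y) = (\<Sum>y\<in>U. v y * N y r)" if "r \<le> b" for r and v :: "'a \<Rightarrow> real"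
    proof -
      have "(\<Sum>x\<in>Z. \<Sum>y\<in>B x r. v y) = (\<Sum>x\<in>Z. \<Sum>y\<in>U. if mdist X x y \<le> r then v y else 0)"
        unfolding B_def using finU by (simp add: sum.If_cases Int_def)
      also have "\<dots> = (\<Sum>y\<in>U. \<Sum>x\<in>Z. if mdist X x y \<le> r then v y else 0)"
        by (rule sum.swap)
      also have "\<dots> = (\<Sum>y\<in>U. v y * N y r)"
      proof (rule sum.cong, rule refl)
        fix y assume "y \<in> U"
        show "(\<Sum>x\<in>Z. if mdist X x y \<le> r then v y else 0) = v y * N y r"
          unfolding NZ[OF \<open>y \<in> U\<close> that] sum_distrib_left by (rule sum.cong) auto
      qed
      finally show ?thesis .
    qed
    have Nb: "N y b \<noteq> 0" if "y \<in> U" for y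
    proof -
      have "y \<in> {z \<in> mspace X. mdist X y z \<le> b}" using that psubset.prems(1) ab by (auto simp: subset_iff mdist_self)
      then show ?thesis unfolding N_def ball_card_def using fin by auto
    qed
    have "(\<Sum>x\<in>Z. \<Sum>y\<in>B x b. w y * p y) = (\<Sum>x\<in>Z. \<Sum>y\<in>B x a. w y)"
      unfolding swap[OF order_refl] swap[OF ab(2)]
      using Nb by (intro sum.cong) (auto simp: p_def)
    moreover have "(\<Sum>x\<in>Z. \<Sum>y\<in>B x a. w y) < (\<Sum>x\<in>Z. \<Sum>y\<in>B x b. w y * p y)"
      if "\<And>x. x \<in> Z \<Longrightarrow> (\<Sum>y\<in>B x a. w y) < (\<Sum>y\<in>B x b. w y * p y)"
      using that finZ \<open>x0 \<in> Z\<close> by (intro sum_strict_mono) auto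
    ultimately obtain x where x: "x \<in> Z" "(\<Sum>y\<in>B x b. w y * p y) \<le> (\<Sum>y\<in>B x a. w y)"
      by (metis less_irrefl not_le)
    define V where "V = U - B x b"
    have VU: "V \<subset> U" using x(1) by (auto simp: V_def Z_def B_def)
    have V: "V \<subseteq> mspace X" "\<And>y. y \<in> V \<Longrightarrow> 0 \<le> w y" using psubset.prems VU by auto
    from psubset.IH[OF VU this] obtain S g where S: "S \<subseteq> V" "\<And>y. y \<in> S \<Longrightarrow> g y \<in> mspace X \<and> mdist X y (g y) \<le> a"
      "\<And>y z. y \<in> S \<Longrightarrow> z \<in> S \<Longrightarrow> g y \<noteq> g z \<Longrightarrow> b - a < mdist X y z"
      "(\<Sum>y\<in>V. w y * p y) \<le> (\<Sum>y\<in>S. w y)"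
      unfolding p_def by blast
    define h where "h = (\<lambda>y. if y \<in> S then g y else x)"
    have xX: "x \<in> mspace X" using x by (simp add: Z_def)
    have cross: "b - a < mdist X y z" if "y \<in> S" "z \<in> B x a" for y z
    proof -
      have "y \<in> U" "b < mdist X x y" using that S(1) by (auto simp: V_def B_def)
      moreover have "z \<in> U" "mdist X x z \<le> a" using that by (auto simp: B_def)
      moreover have "mdist X x y \<le> mdist X x z + mdist X z y"
        using xX calculation psubset.prems(1) by (intro mdist_triangle) auto
      ultimately show ?thesis by (simp add: mdist_commute)
    qed
    have disj: "S \<inter> B x a = {}" using S(1) ab by (auto simp: V_def B_def)
    have fins: "finite S" "finite (B x a)" "finite V" "finite (B x b)"
      using S(1) finU by (auto simp: V_def B_def intro: finite_subset)
    have "(\<Sum>y\<in>U. w y * p y) = (\<Sum>y\<in>V. w y * p y) + (\<Sum>y\<in>B x b. w y * p y)"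
      unfolding V_def by (rule sum.subset_diff) (auto simp: B_def finU)
    also have "\<dots> \<le> (\<Sum>y\<in>S \<union> B x a. w y)"
      using S(4) x(2) by (simp add: sum.union_disjoint fins disj)
    finally have "(\<Sum>y\<in>U. w y * p y) \<le> (\<Sum>y\<in>S \<union> B x a. w y)" .
    moreover have "S \<union> B x a \<subseteq> U" using S(1) by (auto simp: V_def B_def)
    moreover have "h y \<in> mspace X \<and> mdist X y (h y) \<le> a" if "y \<in> S \<union> B x a" for y
      using that S(2) xX by (auto simp: h_def B_def mdist_commute)
    moreover have "b - a < mdist X y z" if "y \<in> S \<union> B x a" "z \<in> S \<union> B x a" "h y \<noteq> h z" for y z
      using that S(3) cross cross[of z y] by (auto simp: h_def mdist_commute split: if_splits)
    ultimately show ?thesis unfolding p_def by (intro exI[of _ "S \<union> B x a"] exI[of _ h] conjI ballI impI) auto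
  qed
qed

section \<open>Fragmentation at many scales\<close>

lemma ball_card_pos:
  assumes "finite (mspace X)" "y \<in> mspace X" "0 \<le> r"
  shows "0 < ball_card X y r"
proof -
  have "y \<in> {z \<in> mspace X. mdist X y z \<le> r}" using assms by (auto simp: mdist_self)
  then show ?thesis unfolding ball_card_def using assms by (subst card_gt_0_iff) auto
qed

lemma ball_card_le_card:
  assumes "finite (mspace X)"
  shows "ball_card X y r \<le> card (mspace X)"
  unfolding ball_card_def using assms by (intro card_mono) auto

text \<open>
  The survival ratios of the later scales are put into the weights of the earlier ones, so that the
  average is taken only once, over the product of all ratios.  The scales need not be related
  to each other: the maps \<open>g k\<close> send a point to the centre of its cluster at scale \<open>k\<close>.
\<close>

lemma fragment_scales:
  fixes X :: "'a metric" and w :: "'a \<Rightarrow> real" and a b :: "nat \<Rightarrow> real"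
  assumes fin: "finite (mspace X)" and ab: "\<And>k. 0 \<le> a k" "\<And>k. a k \<le> b k"
    and U: "U \<subseteq> mspace X" and w: "\<And>y. y \<in> U \<Longrightarrow> 0 \<le> w y"
  shows "\<exists>S g. S \<subseteq> U \<and> (\<forall>k<L. \<forall>y\<in>S. g k y \<in> mspace X \<and> mdist X y (g k y) \<le> a k) \<and>
    (\<forall>k<L. \<forall>y\<in>S. \<forall>z\<in>S. g k y \<noteq> g k z \<longrightarrow> b k - a k < mdist X y z) \<and>
    (\<Sum>y\<in>U. w y * (\<Prod>k<L. ball_card X y (a k) / ball_card X y (b k))) \<le> (\<Sum>y\<in>S. w y)"
  using w
proof (induction L arbitrary: w)
  case 0
  show ?case by (rule exI[of _ U]) simp
next
  case (Suc L)
  define p where "p = (\<lambda>k y. real (ball_card X y (a k)) / real (ball_card X y (b k)))"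
  have "0 \<le> w y * p L y" if "y \<in> U" for y
    using Suc.prems[OF that] by (simp add: p_def)
  from Suc.IH[of "\<lambda>y. w y * p L y", OF this] obtain S g where S: "S \<subseteq> U"
    "\<forall>k<L. \<forall>y\<in>S. g k y \<in> mspace X \<and> mdist X y (g k y) \<le> a k"
    "\<forall>k<L. \<forall>y\<in>S. \<forall>z\<in>S. g k y \<noteq> g k z \<longrightarrow> b k - a k < mdist X y z"
    "(\<Sum>y\<in>U. w y * p L y * (\<Prod>k<L. p k y)) \<le> (\<Sum>y\<in>S. w y * p L y)"
    unfolding p_def by blast
  have "S \<subseteq> mspace X" "\<And>y. y \<in> S \<Longrightarrow> 0 \<le> w y" using S(1) U Suc.prems by auto
  from fragment_one_scale[of X "a L" "b L" S w, OF fin ab(1) ab(2) this] obtain S' h where S': "S' \<subseteq> S"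
    "\<forall>y\<in>S'. h y \<in> mspace X \<and> mdist X y (h y) \<le> a L"
    "\<forall>y\<in>S'. \<forall>z\<in>S'. h y \<noteq> h z \<longrightarrow> b L - a L < mdist X y z"
    "(\<Sum>y\<in>S. w y * p L y) \<le> (\<Sum>y\<in>S'. w y)"
    unfolding p_def by blast
  have "(\<Sum>y\<in>U. w y * (\<Prod>k<Suc L. p k y)) = (\<Sum>y\<in>U. w y * p L y * (\<Prod>k<L. p k y))"
    by (intro sum.cong) (auto simp: mult_ac)
  then have sum_le: "(\<Sum>y\<in>U. w y * (\<Prod>k<Suc L. p k y)) \<le> (\<Sum>y\<in>S'. w y)"
    using S(4) S'(4) by linarith
  show ?case
  proof (intro exI[of _ S'] exI[of _ "g(L := h)"] conjI)
    show "S' \<subseteq> U" using S(1) S'(1) by blast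
    show "\<forall>k<Suc L. \<forall>y\<in>S'. (g(L := h)) k y \<in> mspace X \<and> mdist X y ((g(L := h)) k y) \<le> a k"
      using S(2) S'(1,2) by (auto simp: less_Suc_eq)
    show "\<forall>k<Suc L. \<forall>y\<in>S'. \<forall>z\<in>S'. (g(L := h)) k y \<noteq> (g(L := h)) k z \<longrightarrow> b k - a k < mdist X y z"
      using S(3) S'(1,3) by (auto simp: less_Suc_eq subset_iff)
  qed (use sum_le in \<open>simp add: p_def\<close>)
qed

text \<open>
  Overlapping telescopes: for \<open>q = 1\<close> the sum is a difference of two values, and each further unit of
  shift adds one more such difference.
\<close>

lemma sum_shifted_differences_le:
  fixes F :: "nat \<Rightarrow> real"
  assumes F: "\<And>i. 0 \<le> F i" "\<And>i. F i \<le> B"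
  shows "(\<Sum>i<M. F (i + q) - F i) \<le> q * B"
proof (induction q)
  case 0
  then show ?case by simp
next
  case (Suc q)
  have "(\<Sum>i<M. F (i + Suc q) - F i)
      = (\<Sum>i<M. F (i + q) - F i) + (\<Sum>i<M. F (Suc i + q) - F (i + q))"
    by (simp add: sum.distrib[symmetric])
  also have "(\<Sum>i<M. F (Suc i + q) - F (i + q)) = F (M + q) - F q"
    using sum_lessThan_telescope[of "\<lambda>i. F (i + q)" M] by simp
  finally show ?case using Suc F(1)[of q] F(2)[of "M + q"] by (simp add: algebra_simps)
qed

lemma sum_regroup:
  fixes G :: "nat \<Rightarrow> real"
  shows "(\<Sum>\<tau><T. \<Sum>k<L. G (T * k + \<tau>)) = (\<Sum>i<T * L. G i)"
proof -
  have "(\<Sum>\<tau><T. \<Sum>k<L. G (T * k + \<tau>)) = (\<Sum>k<L. \<Sum>\<tau><T. G (T * k + \<tau>))"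
    by (rule sum.swap)
  also have "\<dots> = (\<Sum>i<T * L. G i)"
  proof (induction L)
    case (Suc L)
    have "(\<Sum>i<T * Suc L. G i) = (\<Sum>i<T * L. G i) + (\<Sum>i<T. G (T * L + i))"
      using sum.atLeastLessThan_concat[of 0 "T * L" "T * L + T" G]
        sum.shift_bounds_nat_ivl[of G 0 "T * L" T]
      by (simp add: lessThan_atLeast0 add.commute)
    then show ?case using Suc by simp
  qed simp
  finally show ?thesis .
qed

text \<open>
  Summed over all shifts $\tau$, the logarithmic losses of one point are at most $q \ln n$, since every
  position on the logarithmic scale is covered at most $q$ times.  By convexity of the exponential, the
  average over $\tau$ of the survival ratios of each point is at least $n^{-q/T}$; hence some shift
  does well for the sum over all points.
\<close>

lemma exists_good_shift:
  fixes X :: "'a metric"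
  defines "n \<equiv> card (mspace X)"
  assumes fin: "finite (mspace X)" and n: "0 < n" and T: "0 < T" and mu: "1 < \<mu>" and u: "0 < u"
  shows "\<exists>\<tau><T. n powr (1 - q / T) \<le>
    (\<Sum>y\<in>mspace X. \<Prod>k<L. ball_card X y (u * \<mu> ^ (T * k + \<tau>)) / ball_card X y (u * \<mu> ^ (T * k + \<tau> + q)))"
proof -
  define F where "F = (\<lambda>y i. ln (ball_card X y (u * \<mu> ^ i)))"
  define E where "E = (\<lambda>y \<tau>. \<Sum>k<L. F y (T * k + \<tau> + q) - F y (T * k + \<tau>))"
  define m where "m = - (q / T) * ln n"
  have pos: "0 < ball_card X y (u * \<mu> ^ i)" if "y \<in> mspace X" for y i
    using mu u by (intro ball_card_pos fin that) auto
  have F: "0 \<le> F y i" "F y i \<le> ln n" if "y \<in> mspace X" for y i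
  proof -
    show "0 \<le> F y i" unfolding F_def using pos[OF that, of i] by (intro ln_ge_zero) linarith
    show "F y i \<le> ln n" unfolding F_def n_def using pos[OF that, of i] ball_card_le_card[OF fin]
      by (subst ln_le_cancel_iff) (auto intro: Suc_leI order.strict_trans2)
  qed
  have prod: "(\<Prod>k<L. ball_card X y (u * \<mu> ^ (T * k + \<tau>)) / ball_card X y (u * \<mu> ^ (T * k + \<tau> + q)))
      = exp (- E y \<tau>)" if "y \<in> mspace X" for y \<tau>
  proof -
    have "exp (- E y \<tau>) = (\<Prod>k<L. exp (F y (T * k + \<tau>) - F y (T * k + \<tau> + q)))"
      by (simp add: E_def sum_negf[symmetric] exp_sum)
    also have "\<dots> = (\<Prod>k<L. ball_card X y (u * \<mu> ^ (T * k + \<tau>)) / ball_card X y (u * \<mu> ^ (T * k + \<tau> + q)))"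
      using pos[OF that] by (intro prod.cong refl) (simp add: F_def exp_diff)
    finally show ?thesis by simp
  qed
  have avg: "T * exp m \<le> (\<Sum>\<tau><T. exp (- E y \<tau>))" if y: "y \<in> mspace X" for y
  proof -
    have "(\<Sum>\<tau><T. E y \<tau>) = (\<Sum>i<T * L. F y (i + q) - F y i)"
      unfolding E_def using sum_regroup[of "\<lambda>i. F y (i + q) - F y i" T L] by simp
    also have "\<dots> \<le> q * ln n" using F[OF y] by (rule sum_shifted_differences_le)
    finally have "(\<Sum>\<tau><T. E y \<tau>) \<le> q * ln n" .
    then have "T * exp m \<le> exp m * (T + (q * ln n - (\<Sum>\<tau><T. E y \<tau>)))" by (simp add: mult.commute)
    \<comment> \<open>Jensen's inequality, through the tangent of \<open>exp\<close> at \<open>m\<close>, a lower bound for the mean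
      of the exponents.\<close>
    also have "\<dots> = (\<Sum>\<tau><T. exp m * (1 + (- E y \<tau> - m)))"
      using T by (simp add: sum_distrib_left[symmetric] sum.distrib sum_subtractf sum_negf m_def)
    also have "\<dots> \<le> (\<Sum>\<tau><T. exp (- E y \<tau>))"
    proof (rule sum_mono)
      fix \<tau>
      have "exp m * (1 + (- E y \<tau> - m)) \<le> exp m * exp (- E y \<tau> - m)"
        by (intro mult_left_mono exp_ge_add_one_self) auto
      then show "exp m * (1 + (- E y \<tau> - m)) \<le> exp (- E y \<tau>)" by (simp add: mult_exp_exp)
    qed
    finally show ?thesis .
  qed
  have "T * (n * exp m) = (\<Sum>y\<in>mspace X. T * exp m)" by (simp add: n_def)
  also have "\<dots> \<le> (\<Sum>y\<in>mspace X. \<Sum>\<tau><T. exp (- E y \<tau>))" using avg by (rule sum_mono)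
  also have "\<dots> = (\<Sum>\<tau><T. \<Sum>y\<in>mspace X. exp (- E y \<tau>))" by (rule sum.swap)
  finally have tot: "(\<Sum>\<tau><T. n * exp m) \<le> (\<Sum>\<tau><T. \<Sum>y\<in>mspace X. exp (- E y \<tau>))" by simp
  have "\<exists>\<tau><T. n * exp m \<le> (\<Sum>y\<in>mspace X. exp (- E y \<tau>))"
  proof (rule ccontr)
    assume "\<not> ?thesis"
    then have "(\<Sum>\<tau><T. \<Sum>y\<in>mspace X. exp (- E y \<tau>)) < (\<Sum>\<tau><T. n * exp m)"
      using T by (intro sum_strict_mono) (auto simp: not_le)
    then show False using tot by linarith
  qed
  moreover have "n powr (1 - q / T) = n * exp m"
    using n by (simp add: powr_def m_def algebra_simps exp_diff exp_minus divide_inverse)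
  ultimately show ?thesis using prod by auto
qed

text \<open>
  The index \<open>k\<close> is the last level at which \<open>x\<close> and \<open>y\<close> lie in different clusters: separation at level
  \<open>k\<close> bounds their distance from below, and the common cluster at level \<open>k + 1\<close> bounds it from above.
  The scales start below the smallest distance, so that distinct points are separated somewhere,
  and end above the diameter.
\<close>

lemma exists_hierarchical_subset:
  fixes X :: "'a metric"
  assumes fin: "finite (mspace X)" and ne: "mspace X \<noteq> {}" and T: "0 < T" and mu: "1 < \<mu>"
  shows "\<exists>S (g :: nat \<Rightarrow> 'a \<Rightarrow> 'a) A. S \<subseteq> mspace X \<and> card (mspace X) powr (1 - q / T) \<le> card S \<and> 0 < A \<and>
    (\<forall>x\<in>S. \<forall>y\<in>S. x \<noteq> y \<longrightarrow> (\<exists>k. g k x \<noteq> g k y \<and> (\<forall>j>k. g j x = g j y) \<and>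
      A * (\<mu> ^ T) ^ k * (\<mu> ^ q - 1) < mdist X x y \<and> mdist X x y \<le> 2 * A * (\<mu> ^ T) ^ Suc k))"
proof -
  define D where "D = {mdist X x y |x y. x \<in> mspace X \<and> y \<in> mspace X \<and> x \<noteq> y}"
  have "D = (\<lambda>(x, y). mdist X x y) ` {(x, y) \<in> mspace X \<times> mspace X. x \<noteq> y}"
    by (auto simp: D_def)
  moreover have "finite {(x, y) \<in> mspace X \<times> mspace X. x \<noteq> y}"
    using fin by (auto intro: finite_subset[of _ "mspace X \<times> mspace X"])
  ultimately have finD: "finite D" by simp
  have Dpos: "0 < r" if "r \<in> D" for r
    using that mdist_nonneg mdist_zero unfolding D_def by (smt (verit, best) mem_Collect_eq)
  \<comment> \<open>Even after a shift by \<open>\<tau> < T\<close> the clusters of level 0 must have a diameter below the smallest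
    distance.  The element 1 keeps \<open>Min\<close> and \<open>Max\<close> defined when there is only one point.\<close>
  define u where "u = Min (insert 1 D) / (4 * \<mu> ^ T)"
  have u: "0 < u" using finD Dpos mu by (auto simp: u_def)
  have small: "2 * (u * \<mu> ^ i) < mdist X x y"
    if "x \<in> mspace X" "y \<in> mspace X" "x \<noteq> y" "i \<le> T" for x y i
  proof -
    have "mdist X x y \<in> D" using that by (auto simp: D_def)
    then have le: "Min (insert 1 D) \<le> mdist X x y" "0 < mdist X x y" using finD Dpos by auto
    have "2 * (u * \<mu> ^ i) \<le> 2 * (u * \<mu> ^ T)" using mu u that by (simp add: power_increasing)
    also have "\<dots> = Min (insert 1 D) / 2" using mu by (simp add: u_def)
    finally show ?thesis using le by linarith
  qed
  have "1 < \<mu> ^ T" using mu T by (simp add: one_less_power)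
  then obtain L where L: "Max (insert 1 D) / u < (\<mu> ^ T) ^ L" using real_arch_pow by blast
  have big: "mdist X x y \<le> u * (\<mu> ^ T) ^ L" if "x \<in> mspace X" "y \<in> mspace X" "x \<noteq> y" for x y
  proof -
    have "mdist X x y \<in> D" using that by (auto simp: D_def)
    then have "mdist X x y \<le> Max (insert 1 D)" using finD by auto
    then show ?thesis using L u by (simp add: field_simps)
  qed
  have n: "0 < card (mspace X)" using fin ne by (simp add: card_gt_0_iff)
  obtain \<tau> where tau: "\<tau> < T" "card (mspace X) powr (1 - q / T) \<le>
    (\<Sum>y\<in>mspace X. \<Prod>k<Suc L. ball_card X y (u * \<mu> ^ (T * k + \<tau>)) / ball_card X y (u * \<mu> ^ (T * k + \<tau> + q)))"
    using exists_good_shift[OF fin n T mu u] by blast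
  define a where "a = (\<lambda>k. u * \<mu> ^ (T * k + \<tau>))"
  define b where "b = (\<lambda>k. u * \<mu> ^ (T * k + \<tau> + q))"
  have ab: "0 \<le> a k" "a k \<le> b k" for k
    using u mu by (auto simp: a_def b_def intro!: power_increasing)
  obtain S g where S: "S \<subseteq> mspace X"
    "\<forall>k<Suc L. \<forall>y\<in>S. g k y \<in> mspace X \<and> mdist X y (g k y) \<le> a k"
    "\<forall>k<Suc L. \<forall>y\<in>S. \<forall>z\<in>S. g k y \<noteq> g k z \<longrightarrow> b k - a k < mdist X y z"
    "(\<Sum>y\<in>mspace X. 1 * (\<Prod>k<Suc L. ball_card X y (a k) / ball_card X y (b k))) \<le> (\<Sum>y\<in>S. 1)"
    using fragment_scales[of X a b "mspace X" "\<lambda>_. 1" "Suc L", OF fin ab order_refl zero_le_one]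
    by (elim exE conjE) (rule that)
  define A where "A = u * \<mu> ^ \<tau>"
  have A: "0 < A" using u mu by (simp add: A_def)
  have aA: "a k = A * (\<mu> ^ T) ^ k" and bA: "b k = A * (\<mu> ^ T) ^ k * \<mu> ^ q" for k
    by (simp_all add: a_def b_def A_def power_add power_mult[symmetric] mult_ac)
  \<comment> \<open>Beyond the last level all points count as one cluster.\<close>
  define h where "h = (\<lambda>k y. if k < Suc L then g k y else undefined)"
  have "\<exists>k. h k x \<noteq> h k y \<and> (\<forall>j>k. h j x = h j y) \<and>
      A * (\<mu> ^ T) ^ k * (\<mu> ^ q - 1) < mdist X x y \<and> mdist X x y \<le> 2 * A * (\<mu> ^ T) ^ Suc k"
    if xy: "x \<in> S" "y \<in> S" "x \<noteq> y" for x y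
  proof -
    have X: "x \<in> mspace X" "y \<in> mspace X" using xy S(1) by auto
    have same: "mdist X x y \<le> 2 * a k" if "k < Suc L" "g k x = g k y" for k
    proof -
      have "mdist X x y \<le> mdist X x (g k x) + mdist X (g k x) y"
        using X S(2)[rule_format, OF that(1) xy(1)] by (intro mdist_triangle) auto
      then show ?thesis using S(2)[rule_format, OF that(1) xy(1)] S(2)[rule_format, OF that(1) xy(2)] that(2)
        by (simp add: mdist_commute)
    qed
    define K where "K = {k. k < Suc L \<and> g k x \<noteq> g k y}"
    have "0 \<in> K"
      using same[of 0] small[OF X xy(3), of \<tau>] tau(1) by (auto simp: K_def a_def)
    have finK: "finite K" by (simp add: K_def)
    define k where "k = Max K"
    have k: "k \<in> K" using finK \<open>0 \<in> K\<close> unfolding k_def by (intro Max_in) auto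
    have above: "h j x = h j y" if "k < j" for j
      using that finK Max_ge[of K j] unfolding k_def[symmetric] by (auto simp: h_def K_def)
    have lower: "A * (\<mu> ^ T) ^ k * (\<mu> ^ q - 1) < mdist X x y"
      using S(3)[rule_format, of k x y] k xy by (simp add: K_def aA bA algebra_simps)
    have upper: "mdist X x y \<le> 2 * A * (\<mu> ^ T) ^ Suc k"
    proof (cases "k = L")
      case True
      have "mdist X x y \<le> u * (\<mu> ^ T) ^ L" using big X xy(3) by simp
      also have "\<dots> \<le> 2 * A * (\<mu> ^ T) ^ Suc L"
      proof (rule mult_mono)
        have "u * 1 \<le> u * \<mu> ^ \<tau>" using u mu by (intro mult_left_mono) auto
        then show "u \<le> 2 * A" using A by (simp add: A_def)
      qed (use \<open>1 < \<mu> ^ T\<close> A in \<open>auto intro: power_increasing\<close>)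
      finally show ?thesis using True by simp
    next
      case False
      then have "Suc k < Suc L" using k by (auto simp: K_def)
      moreover have "g (Suc k) x = g (Suc k) y" using above[of "Suc k"] \<open>Suc k < Suc L\<close> by (simp add: h_def)
      ultimately show ?thesis using same[of "Suc k"] by (simp add: aA)
    qed
    show ?thesis using k above lower upper by (intro exI[of _ k]) (auto simp: K_def h_def)
  qed
  moreover have "card (mspace X) powr (1 - q / T) \<le> card S"
    using tau(2) S(4) by (simp add: a_def b_def)
  ultimately show ?thesis using S(1) A by blast
qed

section \<open>Nearly orthogonal sign vectors\<close>

text \<open>
  The moment generating function of the correlation of \<open>v\<close> with a random sign vector: it is a product
  over the coordinates, and each factor is $e^t + e^{-t} \le 2 (1 + t^2) \le 2 e^{t^2}$.
\<close>

lemma sum_exp_sign_correlation_le: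
  fixes v :: "'i \<Rightarrow> real"
  assumes I: "finite I" and v: "\<And>i. i \<in> I \<Longrightarrow> v i \<in> {-1, 1}" and t: "0 \<le> t" "t \<le> 1"
  shows "(\<Sum>w \<in> I \<rightarrow>\<^sub>E {-1, 1}. exp (t * (\<Sum>i\<in>I. v i * w i))) \<le> (2 * exp (t\<^sup>2)) ^ card I"
proof -
  have two: "exp t + exp (- t) \<le> 2 * exp (t\<^sup>2)"
  proof -
    have "exp t \<le> 1 + t + t\<^sup>2" using t by (rule exp_bound)
    moreover have "exp (- t) \<le> 1 - t + t\<^sup>2"
    proof -
      have "(1 - t + t\<^sup>2) * (1 + t) = 1 + t ^ 3" by (simp add: algebra_simps power2_eq_square power3_eq_cube)
      also have "\<dots> \<ge> 1" using t by simp
      finally have "1 / (1 + t) \<le> 1 - t + t\<^sup>2" using t by (simp add: divide_simps)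
      moreover have "exp (- t) \<le> 1 / (1 + t)"
        using exp_ge_add_one_self[of t] t by (simp add: exp_minus divide_simps)
      ultimately show ?thesis by linarith
    qed
    moreover have "1 + t\<^sup>2 \<le> exp (t\<^sup>2)" by (rule exp_ge_add_one_self)
    ultimately show ?thesis by linarith
  qed
  have "(\<Sum>w \<in> I \<rightarrow>\<^sub>E {-1, 1}. exp (t * (\<Sum>i\<in>I. v i * w i)))
      = (\<Sum>w \<in> I \<rightarrow>\<^sub>E {-1, 1}. \<Prod>i\<in>I. exp (t * v i * w i))"
    by (simp add: exp_sum[OF I, symmetric] sum_distrib_left mult.assoc)
  also have "\<dots> = (\<Prod>i\<in>I. \<Sum>s\<in>{-1, 1}. exp (t * v i * s))"
    by (rule prod_sum_PiE[symmetric]) (use I in auto)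
  also have "\<dots> \<le> (\<Prod>i\<in>I. 2 * exp (t\<^sup>2))"
      proof (rule prod_mono, intro conjI)
    fix i assume "i \<in> I"
    then have "v i = 1 \<or> v i = -1" using v by auto
    then show "(\<Sum>s\<in>{-1, 1}. exp (t * v i * s)) \<le> 2 * exp (t\<^sup>2)" using two by (auto simp: add.commute)
  qed (simp add: sum_nonneg)
  finally show ?thesis by simp
qed

text \<open>
  Chernoff's bound, with parameter $t = \eta / 2$.
\<close>

lemma card_correlated_signs_le:
  fixes v :: "'i \<Rightarrow> real" and \<eta> :: real
  assumes I: "finite I" and v: "\<And>i. i \<in> I \<Longrightarrow> v i \<in> {-1, 1}" and e: "0 \<le> \<eta>" "\<eta> \<le> 1"
  shows "real (card {w \<in> I \<rightarrow>\<^sub>E {-1, 1}. \<eta> * card I < (\<Sum>i\<in>I. v i * w i)})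
    \<le> 2 ^ card I * exp (- (\<eta>\<^sup>2 * card I / 4))"
proof -
  let ?W = "I \<rightarrow>\<^sub>E {-1, 1 :: real}"
  let ?N = "real (card I)"
  define Bad where "Bad = {w \<in> ?W. \<eta> * card I < (\<Sum>i\<in>I. v i * w i)}"
  have fin: "finite ?W" using I by (simp add: finite_PiE)
  then have finB: "finite Bad" by (simp add: Bad_def)
  have "real (card Bad) * exp (\<eta> / 2 * (\<eta> * ?N)) = (\<Sum>w\<in>Bad. exp (\<eta> / 2 * (\<eta> * ?N)))"
    by simp
  also have "\<dots> \<le> (\<Sum>w\<in>Bad. exp (\<eta> / 2 * (\<Sum>i\<in>I. v i * w i)))"
    using e by (intro sum_mono) (auto simp: Bad_def intro!: mult_left_mono)
  also have "\<dots> \<le> (\<Sum>w\<in>?W. exp (\<eta> / 2 * (\<Sum>i\<in>I. v i * w i)))"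
    using fin by (intro sum_mono2) (auto simp: Bad_def)
  also have "\<dots> \<le> (2 * exp ((\<eta> / 2)\<^sup>2)) ^ card I"
    using I v e by (intro sum_exp_sign_correlation_le) auto
  also have "\<dots> = 2 ^ card I * exp (?N * (\<eta> / 2)\<^sup>2)"
    by (simp add: power_mult_distrib exp_of_nat_mult)
  finally have "real (card Bad) * exp (\<eta> / 2 * (\<eta> * ?N)) \<le> 2 ^ card I * exp (?N * (\<eta> / 2)\<^sup>2)" .
  then have "real (card Bad) \<le> 2 ^ card I * exp (?N * (\<eta> / 2)\<^sup>2) / exp (\<eta> / 2 * (\<eta> * ?N))"
    by (simp add: pos_le_divide_eq)
  also have "\<dots> = 2 ^ card I * exp (?N * (\<eta> / 2)\<^sup>2 - \<eta> / 2 * (\<eta> * ?N))"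
    by (simp add: exp_diff)
  also have "?N * (\<eta> / 2)\<^sup>2 - \<eta> / 2 * (\<eta> * ?N) = - (\<eta>\<^sup>2 * ?N / 4)"
    by (simp add: field_simps power2_eq_square)
  finally show ?thesis by (simp add: Bad_def)
qed

text \<open>
  The Gilbert--Varshamov argument: by the previous bound, applied to \<open>v\<close> and to \<open>- v\<close>, each word chosen so far
  excludes only a small fraction of all sign vectors, so a further word can be added.
\<close>

lemma exists_uncorrelated_signs:
  fixes I :: "'i set" and \<eta> :: real
  assumes I: "finite I" and e: "0 \<le> \<eta>" "\<eta> \<le> 1"
    and m: "2 * real m * exp (- (\<eta>\<^sup>2 * card I / 4)) < 1"
  shows "\<exists>c :: nat \<Rightarrow> 'i \<Rightarrow> real. (\<forall>k<m. \<forall>i\<in>I. c k i \<in> {-1, 1}) \<and>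
    (\<forall>k<m. \<forall>l<m. k \<noteq> l \<longrightarrow> \<bar>\<Sum>i\<in>I. c k i * c l i\<bar> \<le> \<eta> * card I)"
  using m
proof (induction m)
  case 0
  then show ?case by simp
next
  case (Suc m)
  let ?W = "I \<rightarrow>\<^sub>E {-1, 1 :: real}"
  let ?E = "exp (- (\<eta>\<^sup>2 * card I / 4))"
  have "2 * real m * ?E \<le> 2 * real (Suc m) * ?E" by (intro mult_right_mono) auto
  then have "2 * real m * ?E < 1" using Suc.prems by linarith
  from Suc.IH[OF this] obtain c :: "nat \<Rightarrow> 'i \<Rightarrow> real" where
    c: "\<And>k i. k < m \<Longrightarrow> i \<in> I \<Longrightarrow> c k i \<in> {-1, 1}"
    "\<And>k l. k < m \<Longrightarrow> l < m \<Longrightarrow> k \<noteq> l \<Longrightarrow> \<bar>\<Sum>i\<in>I. c k i * c l i\<bar> \<le> \<eta> * card I"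
    by metis
  define P where "P = (\<lambda>k. {w \<in> ?W. \<eta> * card I < (\<Sum>i\<in>I. c k i * w i)})"
  define Q where "Q = (\<lambda>k. {w \<in> ?W. \<eta> * card I < (\<Sum>i\<in>I. - c k i * w i)})"
  have fin: "finite ?W" using I by (simp add: finite_PiE)
  have PQ: "real (card (P k \<union> Q k)) \<le> 2 * (2 ^ card I * ?E)" if "k < m" for k
  proof -
    have "real (card (P k)) \<le> 2 ^ card I * ?E" unfolding P_def
      using I c(1)[OF that] e by (intro card_correlated_signs_le) auto
    moreover have "real (card (Q k)) \<le> 2 ^ card I * ?E" unfolding Q_def
      using I c(1)[OF that] e by (intro card_correlated_signs_le) force+
    moreover have "real (card (P k \<union> Q k)) \<le> real (card (P k)) + real (card (Q k))"
      using card_Un_le[of "P k" "Q k"] by linarith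
    ultimately show ?thesis by linarith
  qed
  have "real (card (\<Union>k<m. P k \<union> Q k)) \<le> (\<Sum>k<m. real (card (P k \<union> Q k)))"
    unfolding of_nat_sum[symmetric] of_nat_le_iff by (rule card_UN_le) simp
  also have "\<dots> \<le> (\<Sum>k<m. 2 * (2 ^ card I * ?E))" using PQ by (intro sum_mono) auto
  also have "\<dots> = 2 ^ card I * (2 * real m * ?E)" by simp
  also have "\<dots> < 2 ^ card I" using \<open>2 * real m * ?E < 1\<close> by simp
  also have "\<dots> = real (card ?W)" using I by (simp add: card_PiE)
  finally have "card (\<Union>k<m. P k \<union> Q k) < card ?W" by simp
  moreover have "(\<Union>k<m. P k \<union> Q k) \<subseteq> ?W" by (auto simp: P_def Q_def)
  moreover have "finite (\<Union>k<m. P k \<union> Q k)" using fin by (auto simp: P_def Q_def)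
  ultimately have "\<not> ?W \<subseteq> (\<Union>k<m. P k \<union> Q k)" using card_mono[of "\<Union>k<m. P k \<union> Q k" ?W] by linarith
  then obtain w where w: "w \<in> ?W" "w \<notin> (\<Union>k<m. P k \<union> Q k)" by (auto simp only: subset_iff)
  have new: "\<bar>\<Sum>i\<in>I. c k i * w i\<bar> \<le> \<eta> * card I" if "k < m" for k
    using w that by (force simp: P_def Q_def sum_negf)
  define c' where "c' = c(m := w)"
  have "c' k i \<in> {-1, 1}" if "k < Suc m" "i \<in> I" for k i
    using that c(1) w(1) by (auto simp: c'_def less_Suc_eq PiE_iff)
  moreover have "\<bar>\<Sum>i\<in>I. c' k i * c' l i\<bar> \<le> \<eta> * card I" if "k < Suc m" "l < Suc m" "k \<noteq> l" for k l
    using that c(2) new by (auto simp: c'_def less_Suc_eq mult.commute)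
  ultimately show ?case by blast
qed

section \<open>Embedding a hierarchy into $\ell_p$\<close>

lemma embeds_with_if_bilipschitz:
  assumes f: "f \<in> mspace X \<rightarrow> mspace Y" and AB: "0 < A" "0 < B" "B / A \<le> \<alpha>" and "1 \<le> \<alpha>"
    and bounds: "\<And>x y. x \<in> mspace X \<Longrightarrow> y \<in> mspace X \<Longrightarrow> x \<noteq> y \<Longrightarrow>
      A * mdist X x y \<le> mdist Y (f x) (f y) \<and> mdist Y (f x) (f y) \<le> B * mdist X x y"
  shows "embeds_with \<alpha> X Y"
proof -
  have pos: "0 < mdist X x y" if "x \<in> mspace X" "y \<in> mspace X" "x \<noteq> y" for x y
    using that mdist_nonneg[of X x y] mdist_zero[of x X y] by linarith
  have posY: "0 < mdist Y (f x) (f y)" if "x \<in> mspace X" "y \<in> mspace X" "x \<noteq> y" for x y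
    using bounds[OF that] pos[OF that] AB mult_pos_pos[of A "mdist X x y"] by linarith
  have "inj_on f (mspace X)"
  proof (rule inj_onI, rule ccontr)
    fix x y assume "x \<in> mspace X" "y \<in> mspace X" "f x = f y" "x \<noteq> y"
    then show False using posY[of x y] f by (auto simp: Pi_iff mdist_self)
  qed
  moreover have "distortion X Y f \<le> ennreal \<alpha>"
  proof (cases "\<exists>a. mspace X \<subseteq> {a}")
    case True
    then show ?thesis using \<open>1 \<le> \<alpha>\<close> by (simp add: distortion_def ennreal_leI flip: ennreal_1)
  next
    case False
    have "(SUP (x, y) \<in> {(x, y). x \<in> mspace X \<and> y \<in> mspace X \<and> x \<noteq> y}.
        ennreal (mdist Y (f x) (f y) / mdist X x y)) \<le> ennreal B"
    proof (rule SUP_least, clarify)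
      fix x y assume xy: "x \<in> mspace X" "y \<in> mspace X" "x \<noteq> y"
      show "ennreal (mdist Y (f x) (f y) / mdist X x y) \<le> ennreal B"
        using bounds[OF xy] pos[OF xy] by (intro ennreal_leI) (simp add: divide_le_eq)
    qed
    moreover have "(SUP (x, y) \<in> {(x, y). x \<in> mspace X \<and> y \<in> mspace X \<and> x \<noteq> y}.
        ennreal (mdist X x y / mdist Y (f x) (f y))) \<le> ennreal (1 / A)"
    proof (rule SUP_least, clarify)
      fix x y assume xy: "x \<in> mspace X" "y \<in> mspace X" "x \<noteq> y"
      show "ennreal (mdist X x y / mdist Y (f x) (f y)) \<le> ennreal (1 / A)"
        using bounds[OF xy] posY[OF xy] AB by (intro ennreal_leI) (simp add: field_simps)
    qed
    ultimately have "distortion X Y f \<le> ennreal B * ennreal (1 / A)"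
      using False by (simp add: distortion_def mult_mono)
    also have "\<dots> = ennreal (B / A)" using AB by (simp flip: ennreal_mult)
    also have "\<dots> \<le> ennreal \<alpha>" using AB by (intro ennreal_leI) auto
    finally show ?thesis .
  qed
  ultimately show ?thesis
    unfolding embeds_with_def least_distortion_def using f by (intro INF_lower2[of f]) auto
qed

lemma lp_norm_le_plus_const:
  fixes u v :: "nat \<Rightarrow> real"
  assumes p: "1 \<le> p" and e: "0 \<le> e" and uv: "\<And>i. i < d \<Longrightarrow> \<bar>u i\<bar> \<le> \<bar>v i\<bar> + e"
  shows "(\<Sum>i<d. \<bar>u i\<bar> powr p) powr (1 / p)
    \<le> (\<Sum>i<d. \<bar>v i\<bar> powr p) powr (1 / p) + d powr (1 / p) * e"
proof -
  have "(\<Sum>i<d. \<bar>u i\<bar> powr p) powr (1 / p) \<le> (\<Sum>i<d. (\<bar>v i\<bar> + e) powr p) powr (1 / p)"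
    using p uv by (intro powr_mono2 sum_mono) (auto intro: sum_nonneg)
  also have "\<dots> \<le> (\<Sum>i<d. \<bar>v i\<bar> powr p) powr (1 / p) + (\<Sum>i<d. e powr p) powr (1 / p)"
    using p e by (intro lp_minkowski) auto
  also have "(\<Sum>i<d. e powr p) powr (1 / p) = d powr (1 / p) * e"
    using p e by (simp add: powr_mult powr_powr)
  finally show ?thesis .
qed

lemma geometric_sum_le:
  fixes K :: real
  assumes "1 < K"
  shows "(\<Sum>j<k. K ^ j) \<le> K ^ k / (K - 1)"
  using assms by (simp add: geometric_sum divide_right_mono)

text \<open>
  The distances are measured relative to $d^{1/p}$, the $\ell_p$ norm of the all-ones vector, so that
  \<open>\<gamma>\<close> and \<open>\<beta>\<close> can be chosen independently of the dimension.
\<close>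

definition lp_code :: "real \<Rightarrow> nat \<Rightarrow> real \<Rightarrow> real \<Rightarrow> nat \<Rightarrow> (nat \<Rightarrow> nat \<Rightarrow> real) \<Rightarrow> bool" where
  "lp_code p d \<gamma> \<beta> m c \<longleftrightarrow> (\<forall>k<m. \<forall>i<d. c k i \<in> {0..1}) \<and>
    (\<forall>k<m. \<forall>l<m. k \<noteq> l \<longrightarrow> \<gamma> * d powr (1 / p) \<le> lp_dist p d (c k) (c l) \<and>
      lp_dist p d (c k) (c l) \<le> \<beta> * d powr (1 / p))"

text \<open>
  The embedding adds the code words of all clusters of a point, with weight $K^k$ at level $k$.  For
  two points the levels above the last separating one cancel, and those below contribute at most
  $K^0 + \dots + K^{k-1} \le K^k / (K - 1)$ in every coordinate, because the coordinates of code words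
  lie in $[0,1]$.  So the image distance is $K^k d^{1/p}$ up to factors between
  $\gamma - 1/(K-1)$ and $\beta + 1/(K-1)$.  The clusters are numbered separately at each level, so
  \<open>m\<close> words are enough for \<open>m\<close> points.
\<close>

lemma embeds_hierarchy_into_lp:
  fixes Y :: "'a metric" and g :: "nat \<Rightarrow> 'a \<Rightarrow> 'a"
  assumes fin: "finite (mspace Y)" and card: "card (mspace Y) \<le> m"
    and K: "1 < K" and A: "0 < A" and s: "0 < s"
    and sep: "\<And>x y. x \<in> mspace Y \<Longrightarrow> y \<in> mspace Y \<Longrightarrow> x \<noteq> y \<Longrightarrow>
      \<exists>k. g k x \<noteq> g k y \<and> (\<forall>j>k. g j x = g j y) \<and>
        A * K ^ k * s \<le> mdist Y x y \<and> mdist Y x y \<le> A * K ^ k * t"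
    and p: "1 \<le> p" and d: "0 < d"
    and code: "lp_code p d \<gamma> \<beta> m c"
    and gam: "1 / (K - 1) < \<gamma>" "\<gamma> \<le> \<beta>"
    and alpha: "t / s * ((\<beta> + 1 / (K - 1)) / (\<gamma> - 1 / (K - 1))) \<le> \<alpha>" "1 \<le> \<alpha>"
  shows "embeds_with \<alpha> Y (lp_space p d)"
proof -
  have c01: "\<And>k i. k < m \<Longrightarrow> i < d \<Longrightarrow> c k i \<in> {0..1}"
    and c: "\<And>k l. k < m \<Longrightarrow> l < m \<Longrightarrow> k \<noteq> l \<Longrightarrow>
      \<gamma> * d powr (1 / p) \<le> lp_dist p d (c k) (c l) \<and> lp_dist p d (c k) (c l) \<le> \<beta> * d powr (1 / p)"
    using code by (auto simp: lp_code_def)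
  define \<omega> where "\<omega> = 1 / (K - 1)"
  have om: "0 < \<omega>" "\<omega> < \<gamma>" using K gam by (auto simp: \<omega>_def)
  define D where "D = real d powr (1 / p)"
  have D: "0 < D" using d by (simp add: D_def)
  have "\<exists>\<iota>. inj_on \<iota> (g k ` mspace Y) \<and> \<iota> ` g k ` mspace Y \<subseteq> {..<m}" for k
  proof -
    have "card (g k ` mspace Y) \<le> m" using card_image_le[OF fin, of "g k"] card by linarith
    then show ?thesis using card_le_inj[of "g k ` mspace Y" "{..<m}"] fin by auto
  qed
  then obtain \<iota> where \<iota>: "\<And>k. inj_on (\<iota> k) (g k ` mspace Y)" "\<And>k. \<iota> k ` g k ` mspace Y \<subseteq> {..<m}"
    by metis
  have \<iota>m: "\<iota> k (g k x) < m" if "x \<in> mspace Y" for k x using \<iota>(2) that by blast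
  \<comment> \<open>From some level on there is only one cluster, so the sum that defines the embedding is finite.\<close>
  have "\<exists>k0. \<forall>k\<ge>k0. \<forall>x\<in>mspace Y. \<forall>y\<in>mspace Y. g k x = g k y"
  proof -
    have "\<exists>k0. \<forall>k\<ge>k0. g k x = g k y" if xy: "x \<in> mspace Y" "y \<in> mspace Y" for x y
    proof (cases "x = y")
      case False
      then obtain k where "\<forall>j>k. g j x = g j y" using sep[OF xy] by blast
      then show ?thesis by (intro exI[of _ "Suc k"]) auto
    qed auto
    then obtain k0 where k0: "\<And>x y k. x \<in> mspace Y \<Longrightarrow> y \<in> mspace Y \<Longrightarrow> k0 x y \<le> k \<Longrightarrow> g k x = g k y"
      by metis
    define M where "M = Max (insert 0 ((\<lambda>(x, y). k0 x y) ` (mspace Y \<times> mspace Y)))"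
    have "k0 x y \<le> M" if "x \<in> mspace Y" "y \<in> mspace Y" for x y
      unfolding M_def using fin that by (intro Max_ge) auto
    then show ?thesis using k0 by (intro exI[of _ M]) (meson order_trans)
  qed
  then obtain L where L: "\<And>k x y. L \<le> k \<Longrightarrow> x \<in> mspace Y \<Longrightarrow> y \<in> mspace Y \<Longrightarrow> g k x = g k y"
    by blast
  define f where "f = (\<lambda>x. \<lambda>i\<in>{..<d}. \<Sum>k<L. K ^ k * c (\<iota> k (g k x)) i)"
  have main: "K ^ k * D * (\<gamma> - \<omega>) \<le> lp_dist p d (f x) (f y) \<and> lp_dist p d (f x) (f y) \<le> K ^ k * D * (\<beta> + \<omega>)"
    if xy: "x \<in> mspace Y" "y \<in> mspace Y" and k: "g k x \<noteq> g k y" "\<forall>j>k. g j x = g j y" for x y k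
  proof -
    have kL: "k < L" using L[of k x y] k(1) xy by (meson not_le)
    define v where "v = (\<lambda>i. c (\<iota> k (g k x)) i - c (\<iota> k (g k y)) i)"
    define u where "u = (\<lambda>i. f x i - f y i)"
    define r where "r = (\<lambda>i. \<Sum>j<k. K ^ j * (c (\<iota> j (g j x)) i - c (\<iota> j (g j y)) i))"
    have u: "u i = K ^ k * v i + r i" if i: "i < d" for i
    proof -
      have "u i = (\<Sum>j<L. K ^ j * (c (\<iota> j (g j x)) i - c (\<iota> j (g j y)) i))"
        using i by (simp add: u_def f_def right_diff_distrib sum_subtractf)
      also have "\<dots> = (\<Sum>j<Suc k. K ^ j * (c (\<iota> j (g j x)) i - c (\<iota> j (g j y)) i))"
        using kL k(2) by (intro sum.mono_neutral_right) auto
      finally show ?thesis by (simp add: r_def v_def)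
    qed
    have r: "\<bar>r i\<bar> \<le> K ^ k * \<omega>" if i: "i < d" for i
    proof -
      have "\<bar>r i\<bar> \<le> (\<Sum>j<k. \<bar>K ^ j * (c (\<iota> j (g j x)) i - c (\<iota> j (g j y)) i)\<bar>)"
        unfolding r_def by (rule sum_abs)
      also have "\<dots> \<le> (\<Sum>j<k. K ^ j)"
      proof (rule sum_mono)
        fix j
        have "\<bar>c (\<iota> j (g j x)) i - c (\<iota> j (g j y)) i\<bar> \<le> 1"
          using c01[OF \<iota>m[OF xy(1)] i, of j] c01[OF \<iota>m[OF xy(2)] i, of j] by auto
        then show "\<bar>K ^ j * (c (\<iota> j (g j x)) i - c (\<iota> j (g j y)) i)\<bar> \<le> K ^ j"
          using K by (simp add: abs_mult mult_left_le)
      qed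
      also have "\<dots> \<le> K ^ k * \<omega>" using geometric_sum_le[OF K] by (simp add: \<omega>_def)
      finally show ?thesis .
    qed
    have ne: "\<iota> k (g k x) \<noteq> \<iota> k (g k y)"
      using \<iota>(1)[of k] k(1) xy by (auto simp: inj_on_def)
    have nv: "\<gamma> * D \<le> (\<Sum>i<d. \<bar>v i\<bar> powr p) powr (1 / p)" "(\<Sum>i<d. \<bar>v i\<bar> powr p) powr (1 / p) \<le> \<beta> * D"
      using c[OF \<iota>m[OF xy(1)] \<iota>m[OF xy(2)] ne] by (auto simp: v_def D_def lp_dist_def)
    have nKv: "(\<Sum>i<d. \<bar>K ^ k * v i\<bar> powr p) powr (1 / p) = K ^ k * (\<Sum>i<d. \<bar>v i\<bar> powr p) powr (1 / p)"
    proof -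
      have "(\<Sum>i<d. \<bar>K ^ k * v i\<bar> powr p) = (K ^ k) powr p * (\<Sum>i<d. \<bar>v i\<bar> powr p)"
        using K by (simp add: abs_mult powr_mult sum_distrib_left)
      then show ?thesis using K p by (simp add: powr_mult powr_powr sum_nonneg)
    qed
    have e0: "0 \<le> K ^ k * \<omega>" using K om by simp
    have nu: "lp_dist p d (f x) (f y) = (\<Sum>i<d. \<bar>u i\<bar> powr p) powr (1 / p)"
      by (simp add: lp_dist_def u_def)
    have "(\<Sum>i<d. \<bar>u i\<bar> powr p) powr (1 / p) \<le> (\<Sum>i<d. \<bar>K ^ k * v i\<bar> powr p) powr (1 / p) + D * (K ^ k * \<omega>)"
      unfolding D_def using u r by (intro lp_norm_le_plus_const[OF p e0]) (smt (verit))
    moreover have "(\<Sum>i<d. \<bar>K ^ k * v i\<bar> powr p) powr (1 / p) \<le> (\<Sum>i<d. \<bar>u i\<bar> powr p) powr (1 / p) + D * (K ^ k * \<omega>)"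
      unfolding D_def using u r by (intro lp_norm_le_plus_const[OF p e0]) (smt (verit))
    moreover have "K ^ k * (\<gamma> * D) \<le> K ^ k * (\<Sum>i<d. \<bar>v i\<bar> powr p) powr (1 / p)"
      "K ^ k * (\<Sum>i<d. \<bar>v i\<bar> powr p) powr (1 / p) \<le> K ^ k * (\<beta> * D)"
      using nv K by (auto intro!: mult_left_mono)
    ultimately show ?thesis unfolding nu nKv by (simp add: algebra_simps)
  qed
  show ?thesis
  proof (cases "\<exists>a. mspace Y \<subseteq> {a}")
    case True
    then show ?thesis
      using p alpha(2) by (intro embeds_with_if_bilipschitz[of f _ _ 1 1]) (auto simp: f_def lp_carrier_def)
  next
    case False
    then obtain x0 y0 where "x0 \<in> mspace Y" "y0 \<in> mspace Y" "x0 \<noteq> y0" by blast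
    then obtain k0 where "A * K ^ k0 * s \<le> mdist Y x0 y0" "mdist Y x0 y0 \<le> A * K ^ k0 * t"
      using sep by blast
    then have "A * K ^ k0 * s \<le> A * K ^ k0 * t" by linarith
    moreover have "0 < A * K ^ k0" using A K by simp
    ultimately have t: "0 < t" using s by (simp add: mult_le_cancel_left_pos)
    show ?thesis
    proof (rule embeds_with_if_bilipschitz[of f Y _ "D * (\<gamma> - \<omega>) / (A * t)" "D * (\<beta> + \<omega>) / (A * s)"])
      show "f \<in> mspace Y \<rightarrow> mspace (lp_space p d)" using p by (auto simp: f_def lp_carrier_def)
      show "0 < D * (\<gamma> - \<omega>) / (A * t)" "0 < D * (\<beta> + \<omega>) / (A * s)"
        using D A s t om gam by auto
      have "D * (\<beta> + \<omega>) / (A * s) / (D * (\<gamma> - \<omega>) / (A * t)) = t / s * ((\<beta> + \<omega>) / (\<gamma> - \<omega>))"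
        using D A s t om by (simp add: field_simps)
      then show "D * (\<beta> + \<omega>) / (A * s) / (D * (\<gamma> - \<omega>) / (A * t)) \<le> \<alpha>"
        using alpha(1) by (simp add: \<omega>_def)
      fix x y assume xy: "x \<in> mspace Y" "y \<in> mspace Y" "x \<noteq> y"
      obtain k where k: "g k x \<noteq> g k y" "\<forall>j>k. g j x = g j y"
        "A * K ^ k * s \<le> mdist Y x y" "mdist Y x y \<le> A * K ^ k * t" using sep[OF xy] by blast
      have "D * (\<gamma> - \<omega>) / (A * t) * mdist Y x y \<le> D * (\<gamma> - \<omega>) / (A * t) * (A * K ^ k * t)"
        using k D A t om by (intro mult_left_mono) auto
      also have "\<dots> = K ^ k * D * (\<gamma> - \<omega>)" using A t by simp
      finally have lo: "D * (\<gamma> - \<omega>) / (A * t) * mdist Y x y \<le> K ^ k * D * (\<gamma> - \<omega>)" .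
      have "K ^ k * D * (\<beta> + \<omega>) = D * (\<beta> + \<omega>) / (A * s) * (A * K ^ k * s)" using A s by simp
      also have "\<dots> \<le> D * (\<beta> + \<omega>) / (A * s) * mdist Y x y"
        using k D A s om gam by (intro mult_left_mono) auto
      finally show "D * (\<gamma> - \<omega>) / (A * t) * mdist Y x y \<le> mdist (lp_space p d) (f x) (f y) \<and>
          mdist (lp_space p d) (f x) (f y) \<le> D * (\<beta> + \<omega>) / (A * s) * mdist Y x y"
        using main[OF xy(1,2) k(1,2)] lo p by auto
    qed (rule alpha(2))
  qed
qed

section \<open>Codes in $\ell_p$\<close>

text \<open>
  Replacing the signs by bits turns inner products into Hamming distances.
\<close>

lemma exists_binary_code:
  fixes I :: "'i set" and \<eta> :: real
  assumes I: "finite I" and e: "0 \<le> \<eta>" "\<eta> \<le> 1"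
    and m: "2 * real m * exp (- (\<eta>\<^sup>2 * card I / 4)) < 1"
  shows "\<exists>c :: nat \<Rightarrow> 'i \<Rightarrow> real. (\<forall>k<m. \<forall>i\<in>I. c k i \<in> {0, 1}) \<and>
    (\<forall>k<m. \<forall>l<m. k \<noteq> l \<longrightarrow> (1 - \<eta>) / 2 * card I \<le> (\<Sum>i\<in>I. \<bar>c k i - c l i\<bar>) \<and>
      (\<Sum>i\<in>I. \<bar>c k i - c l i\<bar>) \<le> (1 + \<eta>) / 2 * card I)"
proof -
  obtain s :: "nat \<Rightarrow> 'i \<Rightarrow> real" where signs: "\<forall>k<m. \<forall>i\<in>I. s k i \<in> {-1, 1}"
    "\<forall>k<m. \<forall>l<m. k \<noteq> l \<longrightarrow> \<bar>\<Sum>i\<in>I. s k i * s l i\<bar> \<le> \<eta> * card I"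
    using exists_uncorrelated_signs[OF I e m] by blast
  note s = signs[rule_format]
  define c where "c = (\<lambda>k i. (s k i + 1) / 2)"
  have dist: "(\<Sum>i\<in>I. \<bar>c k i - c l i\<bar>) = (card I - (\<Sum>i\<in>I. s k i * s l i)) / 2" if "k < m" "l < m" for k l
  proof -
    have "(\<Sum>i\<in>I. \<bar>c k i - c l i\<bar>) = (\<Sum>i\<in>I. (1 - s k i * s l i) / 2)"
    proof (rule sum.cong, rule refl)
      fix i assume "i \<in> I"
      then show "\<bar>c k i - c l i\<bar> = (1 - s k i * s l i) / 2"
        using s(1)[OF that(1)] s(1)[OF that(2)] by (fastforce simp: c_def)
    qed
    then show ?thesis by (simp add: sum_divide_distrib[symmetric] sum_subtractf)
  qed
  have "c k i \<in> {0, 1}" if "k < m" "i \<in> I" for k i using s(1)[OF that] by (auto simp: c_def)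
  moreover have "(1 - \<eta>) / 2 * card I \<le> (\<Sum>i\<in>I. \<bar>c k i - c l i\<bar>) \<and>
      (\<Sum>i\<in>I. \<bar>c k i - c l i\<bar>) \<le> (1 + \<eta>) / 2 * card I" if "k < m" "l < m" "k \<noteq> l" for k l
    using s(2)[OF that] unfolding dist[OF that(1,2)] by (simp add: field_simps abs_le_iff)
  ultimately show ?thesis by blast
qed

text \<open>
  Two words can be placed at any prescribed distance.  This covers the case of very few points, in
  which the dimension is too small for the probabilistic bounds.
\<close>

lemma lp_code_two_words:
  assumes p: "1 \<le> p" and "m \<le> 2" and g: "0 \<le> \<gamma>" "\<gamma> \<le> 1" "\<gamma> \<le> \<beta>"
  shows "lp_code p d \<gamma> \<beta> m (\<lambda>k i. if k = 0 then 0 else \<gamma>)"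
proof -
  have "lp_dist p d (\<lambda>i. 0) (\<lambda>i. \<gamma>) = \<gamma> * d powr (1 / p)"
    "lp_dist p d (\<lambda>i. \<gamma>) (\<lambda>i. 0) = \<gamma> * d powr (1 / p)"
    using p g by (simp_all add: lp_dist_def powr_mult powr_powr)
  then show ?thesis
    using assms by (auto simp: lp_code_def mult_right_mono less_Suc_eq numeral_2_eq_2)
qed

text \<open>
  For bits $|s - t|^p = |s - t|$, so the $p$-th power of an $\ell_p$ distance is a Hamming distance.
\<close>

lemma exists_nearly_equilateral_lp_code:
  assumes p: "1 \<le> p" and e: "0 \<le> \<eta>" "\<eta> \<le> 1"
    and m: "m \<le> 2 \<or> 2 * real m * exp (- (\<eta>\<^sup>2 * d / 4)) < 1"
  shows "\<exists>c. lp_code p d (((1 - \<eta>) / 2) powr (1 / p)) (((1 + \<eta>) / 2) powr (1 / p)) m c"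
proof (cases "m \<le> 2")
  case True
  have "((1 - \<eta>) / 2) powr (1 / p) \<le> 1" using e p by (intro powr_le1) auto
  moreover have "((1 - \<eta>) / 2) powr (1 / p) \<le> ((1 + \<eta>) / 2) powr (1 / p)"
    using e p by (intro powr_mono2) auto
  ultimately show ?thesis using lp_code_two_words[OF p True powr_ge_zero] by blast
next
  case False
  then have "2 * real m * exp (- (\<eta>\<^sup>2 * card {..<d} / 4)) < 1" using m by simp
  from exists_binary_code[OF finite_lessThan e this]
  obtain c :: "nat \<Rightarrow> nat \<Rightarrow> real" where words: "\<forall>k<m. \<forall>i\<in>{..<d}. c k i \<in> {0, 1}"
    "\<forall>k<m. \<forall>l<m. k \<noteq> l \<longrightarrow> (1 - \<eta>) / 2 * card {..<d} \<le> (\<Sum>i<d. \<bar>c k i - c l i\<bar>) \<and>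
      (\<Sum>i<d. \<bar>c k i - c l i\<bar>) \<le> (1 + \<eta>) / 2 * card {..<d}"
    by blast
  note c = words[rule_format, unfolded lessThan_iff card_lessThan]
  have "((1 - \<eta>) / 2) powr (1 / p) * d powr (1 / p) \<le> lp_dist p d (c k) (c l) \<and>
      lp_dist p d (c k) (c l) \<le> ((1 + \<eta>) / 2) powr (1 / p) * d powr (1 / p)"
    if "k < m" "l < m" "k \<noteq> l" for k l
  proof -
    have "(\<Sum>i<d. \<bar>c k i - c l i\<bar> powr p) = (\<Sum>i<d. \<bar>c k i - c l i\<bar>)"
      using c(1)[OF that(1)] c(1)[OF that(2)] by (intro sum.cong) fastforce+
    then have eq: "lp_dist p d (c k) (c l) = (\<Sum>i<d. \<bar>c k i - c l i\<bar>) powr (1 / p)"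
      by (simp add: lp_dist_def)
    have "((1 - \<eta>) / 2 * d) powr (1 / p) \<le> (\<Sum>i<d. \<bar>c k i - c l i\<bar>) powr (1 / p)"
      "(\<Sum>i<d. \<bar>c k i - c l i\<bar>) powr (1 / p) \<le> ((1 + \<eta>) / 2 * d) powr (1 / p)"
      using c(2)[OF that] e p by (auto intro!: powr_mono2 sum_nonneg)
    moreover have "((1 - \<eta>) / 2 * d) powr (1 / p) = ((1 - \<eta>) / 2) powr (1 / p) * d powr (1 / p)"
      "((1 + \<eta>) / 2 * d) powr (1 / p) = ((1 + \<eta>) / 2) powr (1 / p) * d powr (1 / p)"
      by (rule powr_mult)+
    ultimately show ?thesis unfolding eq by argo
  qed
  moreover have "c k i \<in> {0..1}" if "k < m" "i < d" for k i using c(1)[OF that] by auto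
  ultimately show ?thesis by (auto simp: lp_code_def intro!: exI[of _ c])
qed

text \<open>
  A binary code of length $hd$ is packed into $d$ coordinates, by numbering the $2^h$ possible blocks of
  $h$ bits.  Two words differ in a quarter of all bits, so in a quarter of all blocks, and
  different blocks have numbers at distance at least 1.  The price is the small constant
  $2^{-h}/4$; the gain is that the number of words may grow like $e^{hd/16}$.
\<close>

lemma exists_low_dimensional_lp_code:
  assumes p: "1 \<le> p" and h: "0 < h"
    and m: "m \<le> 2 \<or> 2 * real m * exp (- (real h * real d / 16)) < 1"
  shows "\<exists>c. lp_code p d (1 / (4 * 2 ^ h)) 1 m c"
proof (cases "m \<le> 2")
  case True
  have "1 / (4 * 2 ^ h) \<le> (1 :: real)" using mult_mono[of 1 4 1 "2 ^ h :: real"] by (simp add: divide_le_eq)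
  then show ?thesis using lp_code_two_words[OF p True, of "1 / (4 * 2 ^ h)" 1] by auto
next
  case False
  let ?I = "{..<d} \<times> {..<h}"
  let ?W = "{..<h} \<rightarrow>\<^sub>E {0, 1 :: real}"
  have "2 * real m * exp (- ((1 / 2)\<^sup>2 * card ?I / 4)) < 1"
    using m False by (simp add: power2_eq_square mult.commute)
  from exists_binary_code[of ?I "1 / 2" m, OF _ _ _ this]
  obtain b :: "nat \<Rightarrow> nat \<times> nat \<Rightarrow> real" where
    b: "\<forall>k<m. \<forall>i\<in>?I. b k i \<in> {0, 1}"
    "\<forall>k<m. \<forall>l<m. k \<noteq> l \<longrightarrow> (1 - 1 / 2) / 2 * real (card ?I) \<le> (\<Sum>i\<in>?I. \<bar>b k i - b l i\<bar>) \<and>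
      (\<Sum>i\<in>?I. \<bar>b k i - b l i\<bar>) \<le> (1 + 1 / 2) / 2 * real (card ?I)"
    by auto
  define B where "B = (\<lambda>k i. \<lambda>j\<in>{..<h}. b k (i, j))"
  have BW: "B k i \<in> ?W" if "k < m" "i < d" for k i using b(1) that by (auto simp: B_def)
  have "finite ?W" "card ?W = 2 ^ h" by (simp_all add: finite_PiE card_PiE numeral_2_eq_2)
  then obtain \<phi> where \<phi>: "bij_betw \<phi> ?W {0..<(2 ^ h :: nat)}"
    using ex_bij_betw_finite_nat[of ?W] by auto
  define c where "c = (\<lambda>k i. real (\<phi> (B k i)) / 2 ^ h)"
  have c01: "c k i \<in> {0..1}" if "k < m" "i < d" for k i
  proof -
    have "\<phi> (B k i) < 2 ^ h" using \<phi> BW[OF that] by (auto simp: bij_betw_def)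
    then have "real (\<phi> (B k i)) < 2 ^ h" by (metis of_nat_less_iff of_nat_numeral of_nat_power)
    then show ?thesis by (simp add: c_def)
  qed
  have "1 / (4 * 2 ^ h) * d powr (1 / p) \<le> lp_dist p d (c k) (c l) \<and> lp_dist p d (c k) (c l) \<le> 1 * d powr (1 / p)"
    if kl: "k < m" "l < m" "k \<noteq> l" for k l
  proof
    define D where "D = {i. i < d \<and> B k i \<noteq> B l i}"
    have D: "finite D" "D \<subseteq> {..<d}" by (auto simp: D_def)
    have "h * (d / 4) \<le> (\<Sum>(i, j)\<in>?I. \<bar>b k (i, j) - b l (i, j)\<bar>)"
      using b(2)[rule_format, OF kl] by (simp add: case_prod_unfold mult.commute)
    also have "\<dots> = (\<Sum>i<d. \<Sum>j<h. \<bar>b k (i, j) - b l (i, j)\<bar>)" by (simp add: sum.cartesian_product)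
    also have "\<dots> \<le> (\<Sum>i<d. if i \<in> D then real h else 0)"
    proof (rule sum_mono)
      fix i assume i: "i \<in> {..<d}"
      show "(\<Sum>j<h. \<bar>b k (i, j) - b l (i, j)\<bar>) \<le> (if i \<in> D then real h else 0)"
      proof (cases "i \<in> D")
        case True
        have "\<bar>b k (i, j) - b l (i, j)\<bar> \<le> 1" if "j < h" for j
          using b(1)[rule_format, OF kl(1), of "(i, j)"] b(1)[rule_format, OF kl(2), of "(i, j)"] i that by auto
        then show ?thesis using True sum_bounded_above[of "{..<h}" "\<lambda>j. \<bar>b k (i, j) - b l (i, j)\<bar>" 1] by simp
      next
        case False
        then have "B k i = B l i" using i by (simp add: D_def)
        then have "b k (i, j) = b l (i, j)" if "j < h" for j using that by (simp add: B_def) (metis lessThan_iff restrict_apply')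
        then show ?thesis using False by simp
      qed
    qed
    also have "\<dots> = h * card D" using D by (simp add: sum.If_cases Int_absorb1)
    finally have Dd: "d / 4 \<le> card D" using h by simp
    have far: "1 / 2 ^ h \<le> \<bar>c k i - c l i\<bar>" if "i \<in> D" for i
    proof -
      have "\<phi> (B k i) \<noteq> \<phi> (B l i)"
        using \<phi> BW[OF kl(1), of i] BW[OF kl(2), of i] that by (auto simp: D_def bij_betw_def inj_on_def)
      then have "1 \<le> \<bar>real (\<phi> (B k i)) - real (\<phi> (B l i))\<bar>" by linarith
      then have "1 / 2 ^ h \<le> \<bar>real (\<phi> (B k i)) - real (\<phi> (B l i))\<bar> / 2 ^ h" by (intro divide_right_mono) auto
      also have "\<dots> = \<bar>c k i - c l i\<bar>" by (simp add: c_def abs_divide flip: diff_divide_distrib)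
      finally show ?thesis .
    qed
    have "1 / (4 * 2 ^ h) * d powr (1 / p) \<le> (1 / 4) powr (1 / p) * (1 / 2 ^ h) * d powr (1 / p)"
    proof (intro mult_right_mono)
      have "1 / 4 \<le> (1 / 4 :: real) powr (1 / p)" using p powr_mono'[of "1 / p" 1 "1 / 4 :: real"] by simp
      then show "1 / (4 * 2 ^ h) \<le> (1 / 4 :: real) powr (1 / p) * (1 / 2 ^ h)"
        by (simp add: field_simps)
    qed auto
    also have "\<dots> = (d / 4 * (1 / 2 ^ h) powr p) powr (1 / p)"
      using p by (simp add: powr_mult powr_powr powr_divide)
    also have "\<dots> \<le> (card D * (1 / 2 ^ h) powr p) powr (1 / p)"
      using p Dd by (intro powr_mono2 mult_right_mono) auto
    also have "\<dots> \<le> (\<Sum>i<d. \<bar>c k i - c l i\<bar> powr p) powr (1 / p)"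
    proof (intro powr_mono2)
      have "card D * (1 / 2 ^ h) powr p = (\<Sum>i\<in>D. (1 / 2 ^ h) powr p)" by simp
      also have "\<dots> \<le> (\<Sum>i\<in>D. \<bar>c k i - c l i\<bar> powr p)" using far p by (intro sum_mono powr_mono2) auto
      also have "\<dots> \<le> (\<Sum>i<d. \<bar>c k i - c l i\<bar> powr p)" using D by (intro sum_mono2) auto
      finally show "card D * (1 / 2 ^ h) powr p \<le> (\<Sum>i<d. \<bar>c k i - c l i\<bar> powr p)" .
    qed (use p in auto)
    finally show "1 / (4 * 2 ^ h) * d powr (1 / p) \<le> lp_dist p d (c k) (c l)" by (simp add: lp_dist_def)
    have "(\<Sum>i<d. \<bar>c k i - c l i\<bar> powr p) \<le> (\<Sum>i<d. 1)"
    proof (rule sum_mono)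
      fix i assume "i \<in> {..<d}"
      then have "\<bar>c k i - c l i\<bar> \<le> 1" using c01[OF kl(1), of i] c01[OF kl(2), of i] by auto
      then show "\<bar>c k i - c l i\<bar> powr p \<le> 1" using p by (intro powr_le1) auto
    qed
    then show "lp_dist p d (c k) (c l) \<le> 1 * d powr (1 / p)"
      unfolding lp_dist_def mult_1 using p by (intro powr_mono2) (auto intro: sum_nonneg)
  qed
  then show ?thesis using c01 by (auto simp: lp_code_def intro!: exI[of _ c])
qed

section \<open>Lower bounds for the Ramsey number of $\ell_p$\<close>

text \<open>
  The greatest number with the Ramsey property exists: a subspace of an \<open>n\<close>-point space has at most \<open>n\<close>
  points, and there is an \<open>n\<close>-point space, the discrete one, to which this applies.
\<close>

lemma ramsey_number_ge:
  assumes "ramsey_property Y \<alpha> n m"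
  shows "m \<le> ramsey_number Y \<alpha> n"
  unfolding ramsey_number_def
proof (rule Greatest_le_nat[where b = n])
  show "ramsey_property Y \<alpha> n m" by (rule assms)
next
  fix k assume k: "ramsey_property Y \<alpha> n k"
  have M: "Metric_space {..<n} (\<lambda>x y :: nat. if x = y then 0 else 1 :: real)"
    by unfold_locales auto
  define Z where "Z = metric ({..<n}, \<lambda>x y :: nat. if x = y then 0 else 1 :: real)"
  have Z: "mspace Z = {..<n}" unfolding Z_def by (rule Metric_space.mspace_metric[OF M])
  then obtain S where "S \<subseteq> {..<n}" "card S = k"
    using k unfolding ramsey_property_def by (metis card_lessThan finite_lessThan)
  then show "k \<le> n" using card_mono[of "{..<n}" S] by simp
qed

text \<open>
  The combination of the two halves of the proof.  The hypotheses on the code and the dimension are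
  restricted to \<open>n \<noteq> 1\<close>, since for \<open>n = 1\<close> the dimension is 0.
\<close>

lemma powr_le_ramsey_number_lp:
  fixes \<alpha> \<mu> x K :: real and q T n d :: nat
  defines "x \<equiv> n powr (1 - q / T)" and "K \<equiv> \<mu> ^ T"
  assumes p: "1 \<le> p" and \<alpha>: "1 \<le> \<alpha>" and n: "0 < n" and q: "0 < q" "q \<le> T" and mu: "1 < \<mu>"
    and d: "n \<noteq> 1 \<Longrightarrow> 0 < d"
    and code: "n \<noteq> 1 \<Longrightarrow> \<exists>c. lp_code p d \<gamma> \<beta> (nat \<lceil>x\<rceil>) c"
    and gam: "1 / (K - 1) < \<gamma>" "\<gamma> \<le> \<beta>"
    and dist: "2 * K / (\<mu> ^ q - 1) * ((\<beta> + 1 / (K - 1)) / (\<gamma> - 1 / (K - 1))) \<le> \<alpha>"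
  shows "x \<le> ramsey_number (lp_space p d) \<alpha> n"
proof -
  have T: "0 < T" using q by simp
  have "ramsey_property (lp_space p d) \<alpha> n (nat \<lceil>x\<rceil>)"
    unfolding ramsey_property_def
  proof (intro allI impI, elim conjE)
    fix X :: "nat metric" assume X: "finite (mspace X)" "card (mspace X) = n"
    have "mspace X \<noteq> {}" using X n by auto
    from exists_hierarchical_subset[OF X(1) this T mu, of q]
    obtain S A and g :: "nat \<Rightarrow> nat \<Rightarrow> nat" where S: "S \<subseteq> mspace X"
      "card (mspace X) powr (1 - q / T) \<le> card S" "0 < A"
      "\<forall>x\<in>S. \<forall>y\<in>S. x \<noteq> y \<longrightarrow> (\<exists>k. g k x \<noteq> g k y \<and> (\<forall>j>k. g j x = g j y) \<and>
        A * (\<mu> ^ T) ^ k * (\<mu> ^ q - 1) < mdist X x y \<and> mdist X x y \<le> 2 * A * (\<mu> ^ T) ^ Suc k)"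
      by (elim exE conjE) (rule that)
    have "x \<le> card S" using S(2) X(2) by (simp add: x_def)
    then have "nat \<lceil>x\<rceil> \<le> card S" by (simp add: nat_le_iff ceiling_le_iff)
    then obtain R where R: "R \<subseteq> S" "card R = nat \<lceil>x\<rceil>" by (meson obtain_subset_with_card_n)
    have RX: "R \<subseteq> mspace X" using R(1) S(1) by blast
    have R': "mspace (submetric X R) = R" using RX by (simp add: Int_absorb2)
    have "embeds_with \<alpha> (submetric X R) (lp_space p d)"
    proof (cases "n = 1")
      case True
      then have "card R = 1" using R(2) by (simp add: x_def)
      then obtain a where "R = {a}" by (auto simp: card_1_singleton_iff)
      then show ?thesis
        using R' p \<alpha> by (intro embeds_with_if_bilipschitz[of "\<lambda>_. \<lambda>i\<in>{..<d}. 0" _ _ 1 1]) (auto simp: lp_carrier_def)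
    next
      case False
      obtain c where c: "lp_code p d \<gamma> \<beta> (nat \<lceil>x\<rceil>) c" using code[OF False] by blast
      show ?thesis
      proof (rule embeds_hierarchy_into_lp[where K = K and g = g and A = A and s = "\<mu> ^ q - 1" and t = "2 * K",
            OF _ _ _ _ _ _ p d[OF False] c gam _ \<alpha>])
        show "finite (mspace (submetric X R))" using RX X(1) R' finite_subset by metis
        show "card (mspace (submetric X R)) \<le> nat \<lceil>x\<rceil>" using R' R(2) by simp
        show "1 < K" unfolding K_def using mu T by (rule one_less_power)
        show "0 < A" by (rule S(3))
        show "0 < \<mu> ^ q - 1" using one_less_power[OF mu q(1)] by simp
        show "2 * K / (\<mu> ^ q - 1) * ((\<beta> + 1 / (K - 1)) / (\<gamma> - 1 / (K - 1))) \<le> \<alpha>" by (rule dist)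
        fix y z assume "y \<in> mspace (submetric X R)" "z \<in> mspace (submetric X R)" "y \<noteq> z"
        then have "y \<in> S" "z \<in> S" "y \<noteq> z" using R' R(1) by auto
        then obtain k where "g k y \<noteq> g k z" "\<forall>j>k. g j y = g j z"
          "A * (\<mu> ^ T) ^ k * (\<mu> ^ q - 1) < mdist X y z" "mdist X y z \<le> 2 * A * (\<mu> ^ T) ^ Suc k"
          using S(4) by blast
        then show "\<exists>k. g k y \<noteq> g k z \<and> (\<forall>j>k. g j y = g j z) \<and>
            A * K ^ k * (\<mu> ^ q - 1) \<le> mdist (submetric X R) y z \<and>
            mdist (submetric X R) y z \<le> A * K ^ k * (2 * K)"
          by (intro exI[of _ k]) (auto simp: K_def mult_ac)
      qed
    qed
    then show "\<exists>S\<subseteq>mspace X. card S = nat \<lceil>x\<rceil> \<and> embeds_with \<alpha> (submetric X S) (lp_space p d)"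
      using RX R(2) by blast
  qed
  then have "nat \<lceil>x\<rceil> \<le> ramsey_number (lp_space p d) \<alpha> n" by (rule ramsey_number_ge)
  then show ?thesis by linarith
qed

text \<open>
  If \<open>x > 2\<close> then twice the number of words is at most $2(x + 1) \le x^3$, so a code length proportional
  to $\ln x$ is enough; for smaller \<open>x\<close> the number of words is at most 2.
\<close>

lemma code_size_bound:
  fixes x N :: real
  assumes x: "0 < x" and N: "3 * ln x < N"
  shows "nat \<lceil>x\<rceil> \<le> 2 \<or> 2 * real (nat \<lceil>x\<rceil>) * exp (- N) < 1"
proof (cases "x \<le> 2")
  case True
  then have "nat \<lceil>x\<rceil> \<le> 2" by (simp add: nat_le_iff ceiling_le_iff)
  then show ?thesis by simp
next
  case False
  then have "real (nat \<lceil>x\<rceil>) \<le> x + 1" by linarith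
  moreover have "2 * (x + 1) \<le> x ^ 3"
  proof -
    have "2 * 2 * x \<le> x ^ 3"
      unfolding power3_eq_cube using False by (intro mult_right_mono mult_mono) auto
    moreover have "2 * (x + 1) \<le> 2 * 2 * x" using False by simp
    ultimately show ?thesis by (rule order_trans[rotated])
  qed
  ultimately have "2 * real (nat \<lceil>x\<rceil>) * exp (- N) \<le> x ^ 3 * exp (- N)"
    by (intro mult_right_mono) auto
  also have "x ^ 3 = exp (3 * ln x)" using x exp_of_nat_mult[of 3 "ln x"] by simp
  also have "exp (3 * ln x) * exp (- N) < 1" using N by (simp flip: exp_add)
  finally show ?thesis by simp
qed

text \<open>
  The fragmentation parameters are $q = 1$ and $\mu = K^{1/T}$ with $K = 2^{53}$, so that
  $2 \mu^T / (\mu - 1) \le 2KT$.  The choice of 49 bits per coordinate makes the code long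
  enough, because $49/16 > 3$; then $\gamma = 2^{-51}$, and $K$ is chosen so that $1/(K-1) \le \gamma/2$.
\<close>

lemma ramsey_number_lp_ge_if_large_distortion:
  fixes \<alpha> :: real and T :: nat
  assumes T: "2 \<le> T" and \<alpha>: "2 ^ 107 * real T \<le> \<alpha>" and p: "1 \<le> p" and n: "0 < n"
    and d: "(1 - 1 / T) * ln n \<le> d"
  shows "n powr (1 - 1 / T) \<le> ramsey_number (lp_space p d) \<alpha> n"
proof -
  define K :: real where "K = 2 ^ 53"
  define \<gamma> :: real where "\<gamma> = 1 / (4 * 2 ^ 49)"
  define \<mu> where "\<mu> = K powr (1 / T)"
  have muT: "\<mu> ^ T = K" using T by (simp add: \<mu>_def K_def powr_powr flip: powr_realpow)
  have mu1: "1 / T \<le> \<mu> - 1"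
  proof -
    have "1 \<le> ln K"
      using ln_ge_iff[of K 1] exp_le by (simp add: K_def)
    then have "1 / T \<le> ln \<mu>" using T by (simp add: \<mu>_def K_def divide_right_mono)
    also have "\<dots> \<le> \<mu> - 1" by (rule ln_le_minus_one) (simp add: \<mu>_def K_def)
    finally show ?thesis .
  qed
  have mu: "1 < \<mu>" using mu1 T by (smt (verit) divide_pos_pos of_nat_0_less_iff zero_less_numeral less_le_trans)
  have pos: "0 < (1 - 1 / T) * ln n" if "n \<noteq> 1" using that n T by simp
  have "n powr (1 - real 1 / T) \<le> ramsey_number (lp_space p d) \<alpha> n"
  proof (rule powr_le_ramsey_number_lp[where \<mu> = \<mu> and \<gamma> = \<gamma> and \<beta> = 1 and T = T and q = 1, unfolded muT, OF p _ n _ _ mu])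
    have "1 \<le> T" using T by simp
    then have "1 \<le> (2 :: real) ^ 107 * T" using mult_mono[of 1 "2 ^ 107 :: real" 1 T] by simp
    then show "1 \<le> \<alpha>" using \<alpha> by linarith
    show "0 < d" if "n \<noteq> 1" using pos[OF that] d by linarith
    show "\<exists>c. lp_code p d \<gamma> 1 (nat \<lceil>n powr (1 - real 1 / T)\<rceil>) c" if "n \<noteq> 1"
    proof -
      have "3 * ln (n powr (1 - real 1 / T)) < real 49 * real d / 16"
        using pos[OF that] d n by (simp add: ln_powr)
      from code_size_bound[OF _ this] show ?thesis
        unfolding \<gamma>_def using n by (intro exists_low_dimensional_lp_code p) auto
    qed
    show "1 / (K - 1) < \<gamma>" "\<gamma> \<le> 1" by (simp_all add: K_def \<gamma>_def)
    have "2 * K / (\<mu> ^ 1 - 1) * ((1 + 1 / (K - 1)) / (\<gamma> - 1 / (K - 1))) \<le> (2 ^ 54 * real T) * 2 ^ 53"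
    proof (rule mult_mono)
      have "2 * K / (\<mu> ^ 1 - 1) \<le> 2 * K / (1 / T)" using mu1 T mu by (intro divide_left_mono) (auto simp: K_def)
      then show "2 * K / (\<mu> ^ 1 - 1) \<le> 2 ^ 54 * real T" by (simp add: K_def)
    qed (simp_all add: K_def \<gamma>_def)
    also have "\<dots> = 2 ^ 107 * real T" by simp
    finally show "2 * K / (\<mu> ^ 1 - 1) * ((1 + 1 / (K - 1)) / (\<gamma> - 1 / (K - 1))) \<le> \<alpha>" using \<alpha> by linarith
  qed (use T in auto)
  then show ?thesis by simp
qed

text \<open>
  Here \<open>Q\<close> stands for $\mu^q$ with $\mu = 1 + \theta$.  Each of the factors beyond 2 is $1 + O(\theta)$, and to
  first order the product is $2 + 12 \theta$; the slack up to $2 + 20 \theta$ absorbs the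
  higher powers of $\theta$.
\<close>

lemma distortion_bound_near_two:
  fixes \<theta> \<mu> r \<gamma> \<beta> \<omega> Q :: real
  assumes th: "0 < \<theta>" "\<theta> \<le> 1 / 20" and Q: "8 / \<theta> \<le> Q" and gam: "1 / 4 \<le> \<gamma>"
    and bet: "\<beta> \<le> \<gamma> * ((1 + \<theta>) / (1 - \<theta>))" and om: "0 \<le> \<omega>" "\<omega> \<le> \<theta> / 4"
  shows "2 * (Q * (1 + \<theta>)) / (Q - 1) * ((\<beta> + \<omega>) / (\<gamma> - \<omega>)) \<le> 2 + 20 * \<theta>"
proof -
  have Q1: "1 < Q" "Q * \<theta> \<ge> 1"
  proof -
    have "8 \<le> 8 / \<theta>" using th by (simp add: field_simps)
    then show "1 < Q" using Q by linarith
    show "Q * \<theta> \<ge> 1" using Q th by (simp add: field_simps)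
  qed
  have a: "2 * (Q * (1 + \<theta>)) / (Q - 1) \<le> 2 * (1 + \<theta>) / (1 - \<theta>)"
  proof -
    have "Q * (1 - \<theta>) \<le> Q - 1" using Q1 by (simp add: algebra_simps)
    then have "(2 * (1 + \<theta>)) * (Q * (1 - \<theta>)) \<le> (2 * (1 + \<theta>)) * (Q - 1)"
      using th by (intro mult_left_mono) auto
    then show ?thesis using Q1 th by (simp add: field_simps)
  qed
  have w: "\<omega> \<le> \<gamma> * \<theta>" using om gam th mult_right_mono[of "1/4" \<gamma> \<theta>] by linarith
  have b: "(\<beta> + \<omega>) / (\<gamma> - \<omega>) \<le> ((1 + \<theta>) / (1 - \<theta>) + \<theta>) / (1 - \<theta>)"
  proof -
    have "(\<beta> + \<omega>) / (\<gamma> - \<omega>) \<le> (\<gamma> * ((1 + \<theta>) / (1 - \<theta>)) + \<gamma> * \<theta>) / (\<gamma> - \<gamma> * \<theta>)"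
      using bet w gam th om by (intro frac_le) (auto simp: mult_less_cancel_left2 intro!: add_nonneg_nonneg)
    also have "\<dots> = (\<gamma> * ((1 + \<theta>) / (1 - \<theta>) + \<theta>)) / (\<gamma> * (1 - \<theta>))" by (simp add: algebra_simps)
    also have "\<dots> = ((1 + \<theta>) / (1 - \<theta>) + \<theta>) / (1 - \<theta>)" using gam by simp
    finally show ?thesis .
  qed
  have "2 * (Q * (1 + \<theta>)) / (Q - 1) * ((\<beta> + \<omega>) / (\<gamma> - \<omega>))
      \<le> 2 * (1 + \<theta>) / (1 - \<theta>) * (((1 + \<theta>) / (1 - \<theta>) + \<theta>) / (1 - \<theta>))"
  proof (cases "0 \<le> (\<beta> + \<omega>) / (\<gamma> - \<omega>)")
    case True
    then show ?thesis using a b th by (intro mult_mono) auto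
  next
    case False
    then have "2 * (Q * (1 + \<theta>)) / (Q - 1) * ((\<beta> + \<omega>) / (\<gamma> - \<omega>)) \<le> 0"
      using Q1 th by (intro mult_nonneg_nonpos) auto
    also have "0 \<le> 2 * (1 + \<theta>) / (1 - \<theta>) * (((1 + \<theta>) / (1 - \<theta>) + \<theta>) / (1 - \<theta>))"
      using th by (intro mult_nonneg_nonneg divide_nonneg_nonneg add_nonneg_nonneg) auto
    finally show ?thesis .
  qed
  also have "\<dots> \<le> 2 + 20 * \<theta>"
  proof -
    have "2 * (1 + \<theta>) * (1 + \<theta> + \<theta> * (1 - \<theta>)) \<le> (2 + 20 * \<theta>) * (1 - \<theta>) ^ 3"
    proof -
      have "(2 + 20 * \<theta>) * (1 - \<theta>) ^ 3 - 2 * (1 + \<theta>) * (1 + \<theta> + \<theta> * (1 - \<theta>))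
          = \<theta> * (8 - 56 * \<theta> + 60 * \<theta>\<^sup>2 - 20 * \<theta> ^ 3)"
        by (simp add: algebra_simps power2_eq_square power3_eq_cube)
      moreover have "0 \<le> \<theta> * (8 - 56 * \<theta> + 60 * \<theta>\<^sup>2 - 20 * \<theta> ^ 3)"
      proof -
        have "20 * \<theta> ^ 3 \<le> 20 * \<theta>" using th power_decreasing[of 1 3 \<theta>] by simp
        moreover have "0 \<le> 60 * \<theta>\<^sup>2" by simp
        ultimately show ?thesis using th by (intro mult_nonneg_nonneg) linarith+
      qed
      ultimately show ?thesis by linarith
    qed
    moreover have "2 * (1 + \<theta>) / (1 - \<theta>) * (((1 + \<theta>) / (1 - \<theta>) + \<theta>) / (1 - \<theta>))
        = 2 * (1 + \<theta>) * (1 + \<theta> + \<theta> * (1 - \<theta>)) / (1 - \<theta>) ^ 3"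
      using th by (simp add: field_simps power3_eq_cube)
    ultimately show ?thesis using th by (simp add: pos_divide_le_eq)
  qed
  finally show ?thesis .
qed

text \<open>
  With $\mu = 1 + \theta$ and $T = q + 1$ the exponent is $1 - q/(q+1) = 1/(q+1)$.  The code is binary
  with deviation $\eta = \theta$, which costs the dimension a factor of order $\theta^{-2}$.
\<close>

lemma ramsey_number_lp_ge_if_distortion_near_two:
  fixes \<alpha> \<theta> :: real and q :: nat
  assumes th: "0 < \<theta>" "\<theta> \<le> 1 / 20" and \<alpha>: "2 + 20 * \<theta> \<le> \<alpha>" and q: "8 / \<theta> \<le> (1 + \<theta>) ^ q"
    and p: "1 \<le> p" and n: "0 < n"
    and d: "n \<noteq> 1 \<Longrightarrow> 12 * ((1 - q / Suc q) * ln n) / \<theta>\<^sup>2 < d"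
  shows "n powr (1 - q / Suc q) \<le> ramsey_number (lp_space p d) \<alpha> n"
proof (rule powr_le_ramsey_number_lp[where \<mu> = "1 + \<theta>" and \<gamma> = "((1 - \<theta>) / 2) powr (1 / p)"
      and \<beta> = "((1 + \<theta>) / 2) powr (1 / p)", OF p _ n])
  let ?K = "(1 + \<theta>) ^ Suc q" and ?\<gamma> = "((1 - \<theta>) / 2) powr (1 / p)" and ?\<beta> = "((1 + \<theta>) / 2) powr (1 / p)"
  show "1 \<le> \<alpha>" "1 < 1 + \<theta>" "q \<le> Suc q" using th \<alpha> by auto
  have "q \<noteq> 0"
  proof
    assume "q = 0"
    then show False using q th by (simp add: field_simps)
  qed
  then show "0 < q" by simp
  show "0 < d" if "n \<noteq> 1"
  proof -
    have "0 \<le> 12 * ((1 - q / Suc q) * ln n) / \<theta>\<^sup>2" using n by simp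
    then show ?thesis using d[OF that] by linarith
  qed
  show "\<exists>c. lp_code p d ?\<gamma> ?\<beta> (nat \<lceil>n powr (1 - q / Suc q)\<rceil>) c" if "n \<noteq> 1"
  proof -
    define L where "L = (1 - q / Suc q) * ln n"
    have "12 * L < d * \<theta>\<^sup>2"
      using d[OF that] th by (simp add: L_def[symmetric] pos_divide_less_eq del: of_nat_Suc)
    moreover have "ln (n powr (1 - q / Suc q)) = L"
      using n by (simp add: ln_powr L_def del: of_nat_Suc)
    ultimately have "3 * ln (n powr (1 - q / Suc q)) < \<theta>\<^sup>2 * d / 4"
      by (simp add: mult.commute)
    from code_size_bound[OF _ this] show ?thesis
      using n th by (intro exists_nearly_equilateral_lp_code p) auto
  qed
  have g: "1 / 4 \<le> ?\<gamma>"
  proof -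
    have "1 / 4 \<le> (1 - \<theta>) / 2" using th by simp
    also have "\<dots> \<le> ?\<gamma>" using th p powr_mono'[of "1 / p" 1 "(1 - \<theta>) / 2"] by simp
    finally show ?thesis .
  qed
  have K: "4 / \<theta> \<le> ?K - 1" "0 < ?K - 1"
  proof -
    have "8 / \<theta> * 1 \<le> (1 + \<theta>) ^ q * (1 + \<theta>)" using q th by (intro mult_mono) auto
    moreover have "1 \<le> 4 / \<theta>" using th by (simp add: field_simps)
    ultimately show "4 / \<theta> \<le> ?K - 1" by (simp add: mult.commute)
    then show "0 < ?K - 1" using \<open>1 \<le> 4 / \<theta>\<close> by linarith
  qed
  have om: "1 / (?K - 1) \<le> \<theta> / 4"
    using K th by (simp add: field_simps)
  then show "1 / (?K - 1) < ?\<gamma>" using g th by linarith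
  show "?\<gamma> \<le> ?\<beta>" using th p by (intro powr_mono2) auto
  have "(1 + \<theta>) / 2 = (1 - \<theta>) / 2 * ((1 + \<theta>) / (1 - \<theta>))" using th by (simp add: divide_simps)
  then have "?\<beta> = ?\<gamma> * ((1 + \<theta>) / (1 - \<theta>)) powr (1 / p)" by (simp only: powr_mult)
  also have "\<dots> \<le> ?\<gamma> * ((1 + \<theta>) / (1 - \<theta>))"
    using th p powr_mono[of "1 / p" 1 "(1 + \<theta>) / (1 - \<theta>)"] by (intro mult_left_mono) auto
  finally have b: "?\<beta> \<le> ?\<gamma> * ((1 + \<theta>) / (1 - \<theta>))" .
  have "2 * ((1 + \<theta>) ^ q * (1 + \<theta>)) / ((1 + \<theta>) ^ q - 1) *
      ((?\<beta> + 1 / (?K - 1)) / (?\<gamma> - 1 / (?K - 1))) \<le> 2 + 20 * \<theta>"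
    using K(2) by (intro distortion_bound_near_two th q g b om) auto
  then show "2 * ?K / ((1 + \<theta>) ^ q - 1) * ((?\<beta> + 1 / (?K - 1)) / (?\<gamma> - 1 / (?K - 1))) \<le> \<alpha>"
    using \<alpha> by (simp add: mult.commute)
qed

text \<open>
  The two regimes meet at $\alpha = 2^{108}$.  Above it, $T$ is about $\alpha / 2^{107}$, and the
  multiplier $\lceil c' / (\alpha - 2)^2 \rceil$ of the dimension enters only through being at least 1.  Below it,
  $1 - 2^{109} \ln \alpha / \alpha$ is at most 0, so any positive exponent will do.  The constant $c' = 2^{232}$
  exceeds $12 \cdot 400 \cdot 2^{216}$: the code needs the multiplier $12 / \theta^2$, where $\theta$ is at
  least $(\alpha - 2) / (20 \cdot 2^{108})$.
\<close>

lemma exists_exponent: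
  fixes \<alpha> :: real
  assumes \<alpha>: "2 < \<alpha>"
  shows "\<exists>C. 0 < C \<and> C < 1 \<and> 1 - 2 ^ 109 * ln \<alpha> / \<alpha> \<le> C \<and>
    (\<forall>p n d. 1 \<le> p \<longrightarrow> 0 < n \<longrightarrow>
      int d = \<lceil>real_of_int \<lceil>2 ^ 232 / (\<alpha> - 2)\<^sup>2\<rceil> * C * ln (real n)\<rceil> \<longrightarrow>
      real n powr C \<le> real (ramsey_number (lp_space p d) \<alpha> n))"
proof -
  have ln2: "1 / 2 \<le> ln \<alpha>"
  proof -
    have "exp (1 / 2) ^ 2 \<le> (3 :: real)" using exp_le by (simp flip: exp_of_nat_mult)
    also have "(3 :: real) \<le> 2 ^ 2" by simp
    finally have "exp (1 / 2) \<le> (2 :: real)" by (rule power2_le_imp_le) simp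
    then show ?thesis using \<alpha> by (subst ln_ge_iff) auto
  qed
  have dim: "m * C * ln n \<le> d"
    if "int d = \<lceil>real_of_int \<lceil>2 ^ 232 / (\<alpha> - 2)\<^sup>2\<rceil> * C * ln (real n)\<rceil>" "0 < C" "0 < n"
      "m = 1 \<or> m = 2 ^ 232 / (\<alpha> - 2)\<^sup>2" for d n :: nat and C m :: real
  proof -
    have "m \<le> real_of_int \<lceil>2 ^ 232 / (\<alpha> - 2)\<^sup>2\<rceil>"
    proof -
      have "0 < 2 ^ 232 / (\<alpha> - 2)\<^sup>2" using \<alpha> by simp
      then have "1 \<le> \<lceil>2 ^ 232 / (\<alpha> - 2)\<^sup>2\<rceil>" by linarith
      then have "1 \<le> real_of_int \<lceil>2 ^ 232 / (\<alpha> - 2)\<^sup>2\<rceil>" by linarith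
      then show ?thesis using that(4) le_of_int_ceiling by blast
    qed
    then have "m * (C * ln n) \<le> real_of_int \<lceil>2 ^ 232 / (\<alpha> - 2)\<^sup>2\<rceil> * (C * ln n)"
      using that by (intro mult_right_mono) auto
    also have "\<dots> \<le> d" using that(1) by (simp add: mult.assoc) linarith
    finally show ?thesis by (simp add: mult.assoc)
  qed
  show ?thesis
  proof (cases "2 ^ 108 \<le> \<alpha>")
    case True
    define T where "T = nat \<lfloor>\<alpha> / 2 ^ 107\<rfloor>"
    have T2: "2 \<le> T" using True by (simp add: T_def le_nat_iff le_floor_iff)
    have T_floor: "real T = of_int \<lfloor>\<alpha> / 2 ^ 107\<rfloor>" using \<alpha> by (simp add: T_def)
    have T_le: "2 ^ 107 * real T \<le> \<alpha>"
    proof -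
      have "real T \<le> \<alpha> / 2 ^ 107" unfolding T_floor by (rule of_int_floor_le)
      then show ?thesis by (simp add: field_simps)
    qed
    have T_ge: "\<alpha> \<le> 2 ^ 108 * real T"
    proof -
      have "\<alpha> / 2 ^ 107 \<le> real T + 1" unfolding T_floor by (rule real_of_int_floor_add_one_ge)
      also have "\<dots> \<le> 2 * real T" using T2 by simp
      finally show ?thesis by (simp add: field_simps)
    qed
    have "1 / real T \<le> 2 ^ 108 / \<alpha>" using T_ge T2 \<alpha> by (simp add: field_simps)
    also have "\<dots> \<le> 2 ^ 109 * ln \<alpha> / \<alpha>" using ln2 \<alpha> by (intro divide_right_mono) auto
    finally have "1 - 2 ^ 109 * ln \<alpha> / \<alpha> \<le> 1 - 1 / real T" by simp
    moreover have "0 < 1 - 1 / real T" "1 - 1 / real T < 1" using T2 by auto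
    moreover have "real n powr (1 - 1 / real T) \<le> real (ramsey_number (lp_space p d) \<alpha> n)"
      if "1 \<le> p" "0 < n" "int d = \<lceil>real_of_int \<lceil>2 ^ 232 / (\<alpha> - 2)\<^sup>2\<rceil> * (1 - 1 / real T) * ln (real n)\<rceil>" for p n d
      using dim[OF that(3) \<open>0 < 1 - 1 / real T\<close> that(2), of 1]
      by (intro ramsey_number_lp_ge_if_large_distortion T2 T_le that) simp
    ultimately show ?thesis by blast
  next
    case False
    define \<theta> where "\<theta> = min 1 (\<alpha> - 2) / 20"
    have th: "0 < \<theta>" "\<theta> \<le> 1 / 20" "2 + 20 * \<theta> \<le> \<alpha>" using \<alpha> by (auto simp: \<theta>_def)
    obtain q where "8 / \<theta> < (1 + \<theta>) ^ q" using real_arch_pow[of "1 + \<theta>" "8 / \<theta>"] th by auto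
    then have q: "8 / \<theta> \<le> (1 + \<theta>) ^ q" by simp
    have "q \<noteq> 0"
    proof
      assume "q = 0"
      then show False using q th by (simp add: field_simps)
    qed
    define C where "C = 1 - real q / real (Suc q)"
    have C: "0 < C" "C < 1" using \<open>q \<noteq> 0\<close> by (auto simp: C_def field_simps)
    have "\<alpha> \<le> 2 ^ 109 * ln \<alpha>" using False mult_left_mono[OF ln2, of "2 ^ 109"] by simp
    then have "1 - 2 ^ 109 * ln \<alpha> / \<alpha> \<le> 0" using \<alpha> by (simp add: field_simps)
    then have "1 - 2 ^ 109 * ln \<alpha> / \<alpha> \<le> C" using C by linarith
    moreover have "real n powr C \<le> real (ramsey_number (lp_space p d) \<alpha> n)"
      if "1 \<le> p" "0 < n" "int d = \<lceil>real_of_int \<lceil>2 ^ 232 / (\<alpha> - 2)\<^sup>2\<rceil> * C * ln (real n)\<rceil>" for p n d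
      unfolding C_def
    proof (rule ramsey_number_lp_ge_if_distortion_near_two[OF th q that(1,2)])
      assume "n \<noteq> 1"
      then have pos: "0 < C * ln n" using C that by simp
      have "\<alpha> - 2 \<le> 2 ^ 108 * 20 * \<theta>" using False \<alpha> by (auto simp: \<theta>_def min_def)
      then have "(\<alpha> - 2)\<^sup>2 \<le> (2 ^ 108 * 20 * \<theta>)\<^sup>2" using \<alpha> by (intro power_mono) auto
      then have "12 * (\<alpha> - 2)\<^sup>2 \<le> (12 * (2 ^ 108 * 20)\<^sup>2) * \<theta>\<^sup>2"
        unfolding power_mult_distrib by linarith
      also have "\<dots> < 2 ^ 232 * \<theta>\<^sup>2" using th by (intro mult_strict_right_mono) auto
      finally have "12 * (\<alpha> - 2)\<^sup>2 < 2 ^ 232 * \<theta>\<^sup>2" .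
      then have "12 / \<theta>\<^sup>2 < 2 ^ 232 / (\<alpha> - 2)\<^sup>2" using th \<alpha> by (simp add: field_simps)
      then have "12 / \<theta>\<^sup>2 * (C * ln n) < 2 ^ 232 / (\<alpha> - 2)\<^sup>2 * (C * ln n)" using pos by (rule mult_strict_right_mono)
      also have "\<dots> \<le> d" using dim[OF that(3) C(1) that(2), of "2 ^ 232 / (\<alpha> - 2)\<^sup>2"] by (simp add: mult.assoc)
      finally show "12 * ((1 - real q / real (Suc q)) * ln (real n)) / \<theta>\<^sup>2 < real d"
        unfolding C_def by (simp only: times_divide_eq_left)
    qed
    ultimately show ?thesis using C by blast
  qed
qed

theorem corollary1p7:
  shows "\<exists>c c' :: real. c > 0 \<and> c' > 0 \<and>
    (\<exists>C :: real \<Rightarrow> real.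
      (\<forall>\<alpha>>2. 0 < C \<alpha> \<and> C \<alpha> < 1 \<and> C \<alpha> \<ge> 1 - c * ln \<alpha> / \<alpha>) \<and>
      (\<forall>p \<alpha> :: real. \<forall>n d :: nat. p \<ge> 1 \<longrightarrow> \<alpha> > 2 \<longrightarrow> n \<ge> 1 \<longrightarrow>
         int d = \<lceil>real_of_int \<lceil>c' / (\<alpha> - 2)\<^sup>2\<rceil> * C \<alpha> * ln (real n)\<rceil> \<longrightarrow>
         real (ramsey_number (lp_space p d) \<alpha> n) \<ge> real n powr C \<alpha>))"
proof -
  obtain C where C: "\<And>\<alpha> :: real. 2 < \<alpha> \<Longrightarrow> 0 < C \<alpha> \<and> C \<alpha> < 1 \<and> 1 - 2 ^ 109 * ln \<alpha> / \<alpha> \<le> C \<alpha> \<and>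
    (\<forall>p n d. 1 \<le> p \<longrightarrow> 0 < n \<longrightarrow>
      int d = \<lceil>real_of_int \<lceil>2 ^ 232 / (\<alpha> - 2)\<^sup>2\<rceil> * C \<alpha> * ln (real n)\<rceil> \<longrightarrow>
      real n powr C \<alpha> \<le> real (ramsey_number (lp_space p d) \<alpha> n))"
    using exists_exponent by metis
  show ?thesis
  proof (rule exI[of _ "2 ^ 109"], rule exI[of _ "2 ^ 232"], intro exI[of _ C] conjI allI impI)
    fix p \<alpha> :: real and n d :: nat
    assume "p \<ge> 1" "\<alpha> > 2" "n \<ge> 1"
      "int d = \<lceil>real_of_int \<lceil>2 ^ 232 / (\<alpha> - 2)\<^sup>2\<rceil> * C \<alpha> * ln (real n)\<rceil>"
    then show "real n powr C \<alpha> \<le> real (ramsey_number (lp_space p d) \<alpha> n)" using C[of \<alpha>] by simp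
  qed (use C in auto)
qed

end
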